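(* Let $\{f_n\}$ be a sequence of additive arithmetic functions. Put $A_n=\sum_{p\le n} f_n(p)/p$ and $B_n^2=\sum_{p\le n} f_n(p)^2/p$ ($p$ prime). Assume there is $n_0$ with $A_n\ne 0$ and $B_n>0$ for all $n\ge n_0$. Let $g$ be a real-valued function whose domain contains $[1-\delta,1+\delta]$ for some $\delta>0$, differentiable at $1$ with $g'(1)\ne0$. Assume that, as $n\to\infty$: $f_n(m)/B_n\to0$ for every $m\in\mathbb{N}$, $\max_{p\le n}|f_n(p)|/B_n\to 0$, and $|A_n|/B_n\to\infty$. Then $$\frac{g(f_n/A_n)-g(1)}{g'(1)(B_n/A_n)}\Rightarrow\Phi.$$
   Context: An arithmetic function $f$ is additive if $f(m_1m_2)=f(m_1)+f(m_2)$ for coprime positive integers $m_1,m_2$. $\Phi$ is the standard normal distribution function. $\mathbb{P}_n$ is the uniform probability measure on $\{1,\dots,n\}$. For functions $h_n$ defined on sets $\mathbb{M}_n\subseteq\{1,\dots,n\}$ (for $n$ large) with $\mathbb{P}_n(\mathbb{M}_n)\to1$, $h_n\Rightarrow\Phi$ means $\mathbb{P}_n(\{m\in\mathbb{M}_n:h_n(m)\le x\})\to\Phi(x)$ for all $x\in\mathbb{R}$. Here $\mathbb{M}_n$ may be taken as the set of $m\in\{n_0,\dots,n\}$ with $f_n(m)/A_n\in[1-\delta,1+\delta]$, i.e. the set where the expression is defined; the notion does not depend on the choice of such domains with $\mathbb{P}_n(\mathbb{M}_n)\to1$. *)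

theory Defs
  imports "HOL-Probability.Probability" "HOL-Computational_Algebra.Primes"
begin

(* Arithmetic functions are total on nat; only their values at positive integers matter. *)
definition additive_arith :: "(nat \<Rightarrow> real) \<Rightarrow> bool" where
  "additive_arith f \<longleftrightarrow>
     (\<forall>m1 m2. 0 < m1 \<longrightarrow> 0 < m2 \<longrightarrow> coprime m1 m2 \<longrightarrow> f (m1 * m2) = f m1 + f m2)"

definition A_sum :: "(nat \<Rightarrow> real) \<Rightarrow> nat \<Rightarrow> real" where
  "A_sum f n = (\<Sum>p | prime p \<and> p \<le> n. f p / real p)"

definition B_sum :: "(nat \<Rightarrow> real) \<Rightarrow> nat \<Rightarrow> real" where
  "B_sum f n = sqrt (\<Sum>p | prime p \<and> p \<le> n. (f p)\<^sup>2 / real p)"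

(* The value at n = 0 is unspecified and plays no role: only limits in n are taken. *)
definition unif_prob :: "nat \<Rightarrow> nat set \<Rightarrow> real" where
  "unif_prob n S = measure_pmf.prob (pmf_of_set {1..n}) S"

definition std_normal_cdf :: "real \<Rightarrow> real" where
  "std_normal_cdf x = cdf std_normal_distribution x"

(* M n is the domain of h n; values of h n outside M n are ignored. *)
definition conv_in_law_on ::
    "(nat \<Rightarrow> nat set) \<Rightarrow> (nat \<Rightarrow> nat \<Rightarrow> real) \<Rightarrow> (real \<Rightarrow> real) \<Rightarrow> bool" where
  "conv_in_law_on M h F \<longleftrightarrow>
     (\<forall>\<^sub>F n in sequentially. M n \<subseteq> {1..n}) \<and>
     (\<lambda>n. unif_prob n (M n)) \<longlonglongrightarrow> 1 \<and>
     (\<forall>x. (\<lambda>n. unif_prob n {m \<in> M n. h n m \<le> x}) \<longlonglongrightarrow> F x)"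

end

theory Submission
  imports Defs
begin

text \<open>
  With a p = f n p / B n, only the primes p with p ^ (2 K) \<le> n matter: a number m \<le> n has at most
  2 K larger prime divisors, each contributing at most max |a p| \<rightarrow> 0. For the small primes the events
  p dvd m are compared with independent events of probability 1 / p. The first K moments of the two
  centred sums differ by O(n powr (- 1 / 2)), and the exponential moments of the independent model
  are bounded, so by Taylor expansion the characteristic functions differ asymptotically by at most
  a constant times 1 / 2 ^ K; finally K is arbitrary. The higher prime powers are removed because a
  square d^2 with d > D divides m with probability at most 1 / D, and the resulting central limit
  theorem is transferred through g by linearisation at 1.
\<close>

section \<open>Independent Bernoulli model\<close>

text \<open>The obstacle is dependence: the probability of a joint divisibility event is known only
  up to \<open>1 / n\<close>, and a K-th moment expands into many such events. If \<open>c\<close>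
  primes are kept, the total error is at most \<open>(1 + 2 * c) ^ K / n\<close>. The cutoff
  \<open>p ^ (2 * K) \<le> n\<close> forces \<open>c ^ (2 * K) \<le> n\<close>, so the numerator is
  at most \<open>3 ^ K * sqrt n\<close>; this is the origin of the exponent 2 K. Counting also
  replaces Mertens' theorem: as no \<open>m\<close> has more than 2 K large prime divisors, the
  reciprocals of the large primes up to \<open>n\<close> sum to at most 4 K. That is crude but
  bounded, while the coefficients tend to 0, so for fixed K both the discarded terms and the
  discarded variance vanish. The factor 1 / 2 ^ K comes from taking the exponential moment at twice
  \<bar>t\<bar>. The values at higher prime powers are not controlled uniformly; outside a set of
  small probability only finitely many fixed arguments occur, where the pointwise assumption on
  \<open>f n m / B n\<close> applies.\<close>

definition bern_weight :: "('a \<Rightarrow> real) \<Rightarrow> 'a set \<Rightarrow> 'a set \<Rightarrow> real" where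
  "bern_weight q S T = (\<Prod>p\<in>T. q p) * (\<Prod>p\<in>S - T. 1 - q p)"

text \<open>A finite sum over \<open>Pow S\<close> instead of an integral; the free value type lets
  real moments and complex characteristic functions share one product formula.\<close>

definition bern_mean :: "('a \<Rightarrow> real) \<Rightarrow> 'a set \<Rightarrow> ('a set \<Rightarrow> 'b) \<Rightarrow> 'b::{real_normed_field}" where
  "bern_mean q S F = (\<Sum>T\<in>Pow S. of_real (bern_weight q S T) * F T)"

lemma bern_mean_real:
  fixes F :: "'a set \<Rightarrow> real"
  shows "bern_mean q S F = (\<Sum>T\<in>Pow S. bern_weight q S T * F T)"
  by (simp add: bern_mean_def)

text \<open>This is independence: expanding the product of sums by distributivity gives one term for
  each subset \<open>T\<close>.\<close>

lemma bern_mean_prod: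
  assumes "finite S"
  shows "bern_mean q S (\<lambda>T. \<Prod>p\<in>S. if p \<in> T then g p else h p) =
         (\<Prod>p\<in>S. of_real (q p) * g p + of_real (1 - q p) * h p)"
proof -
  have "(\<Prod>p\<in>S. of_real (q p) * g p + of_real (1 - q p) * h p) =
        (\<Sum>T\<in>Pow S. (\<Prod>p\<in>T. of_real (q p) * g p) * (\<Prod>p\<in>S - T. of_real (1 - q p) * h p))"
    by (rule prod_add[OF assms])
  also have "\<dots> = (\<Sum>T\<in>Pow S. of_real (bern_weight q S T) * (\<Prod>p\<in>S. if p \<in> T then g p else h p))"
  proof (rule sum.cong[OF refl])
    fix T assume T: "T \<in> Pow S"
    hence fin: "finite T" and inter: "S \<inter> T = T" and diff: "S \<inter> - T = S - T"
      using assms finite_subset by auto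
    have "(\<Prod>p\<in>S. if p \<in> T then g p else h p) = (\<Prod>p\<in>T. g p) * (\<Prod>p\<in>S - T. h p)"
      using prod.If_cases[OF assms, of "\<lambda>p. p \<in> T" g h] by (simp add: inter diff)
    thus "(\<Prod>p\<in>T. of_real (q p) * g p) * (\<Prod>p\<in>S - T. of_real (1 - q p) * h p) =
      of_real (bern_weight q S T) * (\<Prod>p\<in>S. if p \<in> T then g p else h p)"
      by (simp only: bern_weight_def prod.distrib of_real_mult of_real_prod ac_simps)
  qed
  finally show ?thesis by (simp add: bern_mean_def)
qed

lemma bern_weight_nonneg:
  assumes "T \<subseteq> S" "\<And>p. p \<in> S \<Longrightarrow> 0 \<le> q p \<and> q p \<le> 1"
  shows "0 \<le> bern_weight q S T"
  unfolding bern_weight_def using assms by (intro mult_nonneg_nonneg prod_nonneg) auto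

text \<open>The indicator is itself a product over \<open>S\<close>, with a factor 0 for each
  element of \<open>U\<close> missing from \<open>T\<close>. The value is the model's counterpart of
  the density of the multiples of \<open>\<Prod>U\<close>.\<close>

lemma bern_mean_subset:
  assumes "finite S" "U \<subseteq> S"
  shows "bern_mean q S (\<lambda>T. if U \<subseteq> T then 1 else 0) = of_real (\<Prod>p\<in>U. q p)"
proof -
  have "bern_mean q S (\<lambda>T. if U \<subseteq> T then 1 else 0 :: 'b) =
        bern_mean q S (\<lambda>T. \<Prod>p\<in>S. if p \<in> T then 1 else if p \<in> U then 0 else 1)"
    unfolding bern_mean_def
  proof (rule sum.cong[OF refl], rule arg_cong[where f = "(*) _"])
    fix T assume "T \<in> Pow S"
    show "(if U \<subseteq> T then 1 else 0) = (\<Prod>p\<in>S. if p \<in> T then 1 else if p \<in> U then 0 else 1::'b)"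
    proof (cases "U \<subseteq> T")
      case True
      hence "(\<Prod>p\<in>S. if p \<in> T then 1 else if p \<in> U then 0 else 1) = (1::'b)"
        by (intro prod.neutral) auto
      thus ?thesis using True by simp
    next
      case False
      then obtain p where "p \<in> U" "p \<notin> T" by auto
      thus ?thesis using assms False by (auto intro!: prod_zero[symmetric] bexI[of _ p])
    qed
  qed
  also have "\<dots> = (\<Prod>p\<in>S. if p \<in> U then of_real (q p) else 1)"
    unfolding bern_mean_prod[OF assms(1)] by (rule prod.cong) auto
  also have "\<dots> = (\<Prod>p\<in>U. of_real (q p))"
    using assms by (simp add: prod.If_cases Int_absorb1 Int_commute)
  finally show ?thesis by simp
qed

text \<open>\<open>T\<close> is the set of events that occur: a random subset in the model, and
  \<open>{p \<in> S. p dvd m}\<close> for an integer \<open>m\<close>. Both sides of the comparison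
  are thus the same function of \<open>T\<close>.\<close>

definition centered_sum :: "('a \<Rightarrow> real) \<Rightarrow> ('a \<Rightarrow> real) \<Rightarrow> 'a set \<Rightarrow> 'a set \<Rightarrow> real" where
  "centered_sum q a S T = (\<Sum>p\<in>S. a p * ((if p \<in> T then 1 else 0) - q p))"

text \<open>Real \<open>z\<close> yields the exponential moments, \<open>z = \<i> * t\<close> the
  characteristic function.\<close>

lemma bern_mean_exp_centered_sum:
  fixes z :: "'b::{real_normed_field,banach}"
  assumes "finite S"
  shows "bern_mean q S (\<lambda>T. exp (z * of_real (centered_sum q a S T))) =
    (\<Prod>p\<in>S. of_real (q p) * exp (z * of_real (a p * (1 - q p))) +
           of_real (1 - q p) * exp (z * of_real (- a p * q p)))"
proof -
  have "exp (z * of_real (centered_sum q a S T)) =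
     (\<Prod>p\<in>S. if p \<in> T then exp (z * of_real (a p * (1 - q p))) else exp (z * of_real (- a p * q p)))" for T
    unfolding centered_sum_def of_real_sum sum_distrib_left exp_sum[OF assms]
    by (rule prod.cong) auto
  thus ?thesis by (simp only: bern_mean_prod[OF assms])
qed

lemma exp_le_quadratic:
  fixes x :: real
  shows "exp x \<le> 1 + x + x\<^sup>2 * exp \<bar>x\<bar>"
proof (cases "x \<ge> 0")
  case True
  have "exp x * (1 - x) \<le> 1"
  proof -
    have "exp x * (1 - x) \<le> exp x * exp (- x)"
      using exp_ge_add_one_self[of "-x"] by (intro mult_left_mono) auto
    thus ?thesis by (simp add: exp_minus)
  qed
  hence 1: "exp x \<le> 1 + x * exp x" by (simp add: algebra_simps)
  \<comment> \<open>The first-order bound is inserted into its own right-hand side.\<close>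
  have "x * exp x \<le> x * (1 + x * exp x)" using 1 True by (intro mult_left_mono) auto
  thus ?thesis using 1 True by (simp add: algebra_simps power2_eq_square)
next
  case False
  define y where "y = - x"
  have y: "y > 0" using False y_def by auto
  have "exp x = inverse (exp y)" by (simp add: y_def exp_minus)
  also have "\<dots> \<le> inverse (1 + y)" using y exp_ge_add_one_self[of y] by (intro le_imp_inverse_le) auto
  also have "\<dots> \<le> 1 - y + y\<^sup>2"
    using y by (simp add: field_simps power2_eq_square)
  also have "\<dots> \<le> 1 - y + y\<^sup>2 * exp y" using y by (simp add: mult_le_cancel_left1)
  finally show ?thesis using y y_def by simp
qed

text \<open>Centring removes the linear terms, so each factor is at most the exponential of a
  multiple of \<open>(a p)\<^sup>2 * q p\<close>, and these sum to at most 1. The bound depends on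
  neither \<open>S\<close> nor \<open>a\<close>, which makes it uniform in \<open>n\<close>
  later.\<close>

lemma bern_mean_exp_le:
  fixes s :: real
  assumes fin: "finite S" and q: "\<And>p. p \<in> S \<Longrightarrow> 0 \<le> q p \<and> q p \<le> 1"
    and a: "\<And>p. p \<in> S \<Longrightarrow> \<bar>a p\<bar> \<le> 1"
    and var: "(\<Sum>p\<in>S. (a p)\<^sup>2 * q p) \<le> 1"
  shows "bern_mean q S (\<lambda>T. exp (s * centered_sum q a S T)) \<le> exp (s\<^sup>2 * exp \<bar>s\<bar>)"
proof -
  have "bern_mean q S (\<lambda>T. exp (s * centered_sum q a S T)) =
    (\<Prod>p\<in>S. q p * exp (s * (a p * (1 - q p))) + (1 - q p) * exp (s * (- a p * q p)))"
    using bern_mean_exp_centered_sum[OF fin, of q s a] by simp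
  also have "\<dots> \<le> (\<Prod>p\<in>S. exp (s\<^sup>2 * exp \<bar>s\<bar> * ((a p)\<^sup>2 * q p)))"
  proof (rule prod_mono, rule conjI)
    fix p assume p: "p \<in> S"
    note q = q[OF p] and a = a[OF p]
    show "0 \<le> q p * exp (s * (a p * (1 - q p))) + (1 - q p) * exp (s * (- a p * q p))"
      using q by simp
    have bd: "exp (s * y) \<le> 1 + s * y + (s * y)\<^sup>2 * exp \<bar>s\<bar>" if "\<bar>y\<bar> \<le> 1" for y
    proof -
      have "\<bar>s * y\<bar> \<le> \<bar>s\<bar>" using mult_left_mono[OF that, of "\<bar>s\<bar>"] by (simp add: abs_mult)
      hence "(s * y)\<^sup>2 * exp \<bar>s * y\<bar> \<le> (s * y)\<^sup>2 * exp \<bar>s\<bar>" by (intro mult_left_mono) auto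
      thus ?thesis using exp_le_quadratic[of "s * y"] by linarith
    qed
    have b1: "\<bar>a p * (1 - q p)\<bar> \<le> 1" and b2: "\<bar>- a p * q p\<bar> \<le> 1"
      using q a by (auto simp: abs_mult intro!: mult_le_one)
    let ?E = "exp \<bar>s\<bar>"
    have "q p * exp (s * (a p * (1 - q p))) + (1 - q p) * exp (s * (- a p * q p)) \<le>
       q p * (1 + s * (a p * (1 - q p)) + (s * (a p * (1 - q p)))\<^sup>2 * ?E) +
       (1 - q p) * (1 + s * (- a p * q p) + (s * (- a p * q p))\<^sup>2 * ?E)"
      using q by (intro add_mono mult_left_mono bd b1 b2) auto
    \<comment> \<open>The two linear terms cancel, and the two squares add up to the variance
      \<open>(a p)\<^sup>2 * q p * (1 - q p)\<close>.\<close>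
    also have "\<dots> = 1 + s\<^sup>2 * ?E * ((a p)\<^sup>2 * q p) * (1 - q p)"
      by (simp add: algebra_simps power2_eq_square)
    also have "\<dots> \<le> 1 + s\<^sup>2 * ?E * ((a p)\<^sup>2 * q p)"
      using q by (simp add: mult_left_le)
    also have "\<dots> \<le> exp (s\<^sup>2 * ?E * ((a p)\<^sup>2 * q p))" by (rule exp_ge_add_one_self)
    finally show "q p * exp (s * (a p * (1 - q p))) + (1 - q p) * exp (s * (- a p * q p)) \<le>
      exp (s\<^sup>2 * ?E * ((a p)\<^sup>2 * q p))" .
  qed
  also have "\<dots> = exp (s\<^sup>2 * exp \<bar>s\<bar> * (\<Sum>p\<in>S. (a p)\<^sup>2 * q p))"
    by (simp add: exp_sum[OF fin] sum_distrib_left)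
  also have "\<dots> \<le> exp (s\<^sup>2 * exp \<bar>s\<bar>)"
    using var by (simp add: mult_left_le)
  finally show ?thesis .
qed

section \<open>Taylor expansion of characteristic functions in moments\<close>

lemma power_div_fact_le_exp:
  fixes x :: real
  assumes "x \<ge> 0"
  shows "x ^ k / fact k \<le> exp x"
proof -
  have "(\<Sum>n\<in>{k}. x ^ n / fact n) \<le> (\<Sum>n. x ^ n / fact n)"
    using summable_exp[of x] assms
    by (intro sum_le_suminf) (auto simp: field_simps)
  also have "\<dots> = exp x" by (simp add: exp_def divide_inverse scaleR_conv_of_real mult.commute)
  finally show ?thesis by simp
qed

lemma sum_power_div_fact_le_exp:
  fixes x :: real
  assumes "x \<ge> 0"
  shows "(\<Sum>k\<le>n. x ^ k / fact k) \<le> exp x"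
proof -
  have "(\<Sum>k\<le>n. x ^ k / fact k) \<le> (\<Sum>k. x ^ k / fact k)"
    using summable_exp[of x] assms
    by (intro sum_le_suminf) (auto simp: field_simps)
  also have "\<dots> = exp x" by (simp add: exp_def divide_inverse scaleR_conv_of_real mult.commute)
  finally show ?thesis by simp
qed

text \<open>Arbitrary nonnegative weights let this serve the uniform law on \<open>{1..n}\<close>,
  the Bernoulli model and a single two-point variable alike.\<close>

lemma char_taylor:
  fixes w X :: "'i \<Rightarrow> real"
  assumes "\<And>i. i \<in> I \<Longrightarrow> 0 \<le> w i"
  shows "cmod ((\<Sum>i\<in>I. w i * iexp (t * X i)) -
           (\<Sum>k\<le>n. (\<i> * t) ^ k / fact k * of_real (\<Sum>i\<in>I. w i * X i ^ k)))
         \<le> \<bar>t\<bar> ^ Suc n / fact (Suc n) * (\<Sum>i\<in>I. w i * \<bar>X i\<bar> ^ Suc n)"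
proof -
  have "(\<Sum>k\<le>n. (\<i> * t) ^ k / fact k * of_real (\<Sum>i\<in>I. w i * X i ^ k)) =
        (\<Sum>i\<in>I. w i * (\<Sum>k\<le>n. (\<i> * of_real (t * X i)) ^ k / fact k))"
    unfolding of_real_sum sum_distrib_left
    by (subst sum.swap) (auto intro!: sum.cong simp: power_mult_distrib field_simps)
  hence "(\<Sum>i\<in>I. w i * iexp (t * X i)) -
           (\<Sum>k\<le>n. (\<i> * t) ^ k / fact k * of_real (\<Sum>i\<in>I. w i * X i ^ k)) =
        (\<Sum>i\<in>I. w i * (iexp (t * X i) - (\<Sum>k\<le>n. (\<i> * of_real (t * X i)) ^ k / fact k)))"
    by (simp add: sum_subtractf right_diff_distrib)
  also have "cmod \<dots> \<le> (\<Sum>i\<in>I. w i * (\<bar>t * X i\<bar> ^ Suc n / fact (Suc n)))"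
  proof (rule sum_norm_le)
    fix i assume "i \<in> I"
    thus "cmod (w i * (iexp (t * X i) - (\<Sum>k\<le>n. (\<i> * of_real (t * X i)) ^ k / fact k)))
       \<le> w i * (\<bar>t * X i\<bar> ^ Suc n / fact (Suc n))"
      unfolding norm_mult norm_of_real using assms iexp_approx1[of "t * X i" n]
      by (simp only: abs_of_nonneg mult_left_mono)
  qed
  also have "\<dots> = \<bar>t\<bar> ^ Suc n / fact (Suc n) * (\<Sum>i\<in>I. w i * \<bar>X i\<bar> ^ Suc n)"
    unfolding sum_distrib_left by (rule sum.cong) (auto simp: abs_mult power_mult_distrib field_simps)
  finally show ?thesis .
qed

text \<open>For even \<open>K\<close> the absolute moment in the Taylor remainder is an ordinary
  moment, so it too can be compared. Hence only the \<open>K\<close>-th moment of \<open>Y\<close>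
  has to be bounded, never that of \<open>X\<close>.\<close>

lemma char_diff_le_moments:
  fixes w X :: "'i \<Rightarrow> real" and v Y :: "'j \<Rightarrow> real"
  assumes w: "\<And>i. i \<in> I \<Longrightarrow> 0 \<le> w i" and v: "\<And>j. j \<in> J \<Longrightarrow> 0 \<le> v j"
    and mom: "\<And>k. k \<le> K \<Longrightarrow> \<bar>(\<Sum>i\<in>I. w i * X i ^ k) - (\<Sum>j\<in>J. v j * Y j ^ k)\<bar> \<le> d"
    and K: "even K" "K > 0"
  shows "cmod ((\<Sum>i\<in>I. w i * iexp (t * X i)) - (\<Sum>j\<in>J. v j * iexp (t * Y j)))
     \<le> d * exp \<bar>t\<bar> + 2 * (\<bar>t\<bar> ^ K / fact K * (\<Sum>j\<in>J. v j * Y j ^ K))"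
proof -
  obtain n where n: "K = Suc n" using K by (cases K) auto
  define m1 where "m1 k = (\<Sum>i\<in>I. w i * X i ^ k)" for k
  define m2 where "m2 k = (\<Sum>j\<in>J. v j * Y j ^ k)" for k
  have d: "d \<ge> 0" using mom[of 0] by linarith
  let ?P = "\<lambda>m :: nat \<Rightarrow> real. \<Sum>k\<le>n. (\<i> * t) ^ k / fact k * complex_of_real (m k)"
  have abs: "\<bar>x\<bar> ^ K = x ^ K" for x :: real using K by (simp add: power_even_abs)
  have 1: "cmod ((\<Sum>i\<in>I. w i * iexp (t * X i)) - ?P m1) \<le> \<bar>t\<bar> ^ K / fact K * m1 K"
    using char_taylor[of I w t X n] w unfolding n[symmetric] abs m1_def by blast
  have 2: "cmod ((\<Sum>j\<in>J. v j * iexp (t * Y j)) - ?P m2) \<le> \<bar>t\<bar> ^ K / fact K * m2 K"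
    using char_taylor[of J v t Y n] v unfolding n[symmetric] abs m2_def by blast
  have "cmod (?P m1 - ?P m2) = cmod (\<Sum>k\<le>n. (\<i> * t) ^ k / fact k * of_real (m1 k - m2 k))"
    by (simp add: sum_subtractf right_diff_distrib)
  also have "\<dots> \<le> (\<Sum>k\<le>n. \<bar>t\<bar> ^ k / fact k * d)"
  proof (rule sum_norm_le)
    fix k assume "k \<in> {..n}"
    hence "\<bar>m1 k - m2 k\<bar> \<le> d" using mom[of k] by (simp add: m1_def m2_def n)
    thus "cmod ((\<i> * t) ^ k / fact k * of_real (m1 k - m2 k)) \<le> \<bar>t\<bar> ^ k / fact k * d"
      unfolding norm_mult norm_divide norm_power norm_of_real norm_fact
      by (intro mult_mono) auto
  qed
  finally have 3: "cmod (?P m1 - ?P m2) \<le> (\<Sum>k\<le>n. \<bar>t\<bar> ^ k / fact k * d)" .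
  \<comment> \<open>Trading the moment of \<open>X\<close> for that of \<open>Y\<close> costs
    \<open>d\<close> times the term of order \<open>K\<close>, which is just the next term of the
    exponential sum in fact 3.\<close>
  have "\<bar>t\<bar> ^ K / fact K * m1 K \<le> \<bar>t\<bar> ^ K / fact K * (m2 K + d)"
    using mom[of K] by (intro mult_left_mono) (auto simp: m1_def m2_def)
  hence 4: "\<bar>t\<bar> ^ K / fact K * m1 K \<le> \<bar>t\<bar> ^ K / fact K * m2 K + \<bar>t\<bar> ^ K / fact K * d"
    by (simp only: distrib_left)
  have "(\<Sum>k\<le>K. \<bar>t\<bar> ^ k / fact k) * d \<le> exp \<bar>t\<bar> * d"
    using d by (intro mult_right_mono sum_power_div_fact_le_exp) auto
  moreover have "(\<Sum>k\<le>n. \<bar>t\<bar> ^ k / fact k * d) + \<bar>t\<bar> ^ K / fact K * d = (\<Sum>k\<le>K. \<bar>t\<bar> ^ k / fact k) * d"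
    by (simp only: n sum.atMost_Suc distrib_right sum_distrib_right)
  ultimately have 5: "(\<Sum>k\<le>n. \<bar>t\<bar> ^ k / fact k * d) + \<bar>t\<bar> ^ K / fact K * d \<le> d * exp \<bar>t\<bar>"
    by (simp only: mult.commute)
  have tri: "cmod (x - y) \<le> cmod (x - p) + cmod (y - r) + cmod (p - r)" for x y p r
    using norm_triangle_ineq4[of "x - p" "y - r"] norm_triangle_ineq[of "x - p - (y - r)" "p - r"]
    by (simp add: algebra_simps)
  show ?thesis
    using tri[of "\<Sum>i\<in>I. w i * iexp (t * X i)" "\<Sum>j\<in>J. v j * iexp (t * Y j)" "?P m1" "?P m2"] 1 2 3 4 5
    unfolding m2_def[symmetric] by linarith
qed

text \<open>Write \<open>\<bar>t * Y\<bar> ^ K\<close> as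
  \<open>(2 * \<bar>t\<bar> * \<bar>Y\<bar>) ^ K / 2 ^ K\<close> and bound the power over the
  factorial by an exponential: doubling the argument gains \<open>1 / 2 ^ K\<close> against a
  constant free of \<open>K\<close>. The factor 2 accounts for the two signs of
  \<open>Y\<close>.\<close>

lemma bern_mean_moment_le:
  assumes fin: "finite S" and q: "\<And>p. p \<in> S \<Longrightarrow> 0 \<le> q p \<and> q p \<le> 1"
    and a: "\<And>p. p \<in> S \<Longrightarrow> \<bar>a p\<bar> \<le> 1"
    and var: "(\<Sum>p\<in>S. (a p)\<^sup>2 * q p) \<le> 1" and K: "even K"
  shows "\<bar>t\<bar> ^ K / fact K * bern_mean q S (\<lambda>T. centered_sum q a S T ^ K)
     \<le> 2 / 2 ^ K * exp (4 * t\<^sup>2 * exp (2 * \<bar>t\<bar>))"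
proof -
  let ?Y = "centered_sum q a S"
  define s where "s = 2 * \<bar>t\<bar>"
  have "\<bar>t\<bar> ^ K / fact K * bern_mean q S (\<lambda>T. ?Y T ^ K) =
        1 / 2 ^ K * bern_mean q S (\<lambda>T. (s * \<bar>?Y T\<bar>) ^ K / fact K)"
    using K unfolding bern_mean_def sum_distrib_left s_def
    by (intro sum.cong) (auto simp: power_mult_distrib power_even_abs)
  also have "\<dots> \<le> 1 / 2 ^ K * bern_mean q S (\<lambda>T. exp (s * ?Y T) + exp (- s * ?Y T))"
    unfolding bern_mean_def
  proof (intro mult_left_mono sum_mono)
    fix T assume "T \<in> Pow S"
    thus "0 \<le> (of_real (bern_weight q S T) :: real)" using bern_weight_nonneg[of T S q] q by auto
    have "(s * \<bar>?Y T\<bar>) ^ K / fact K \<le> exp (s * \<bar>?Y T\<bar>)"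
      by (intro power_div_fact_le_exp) (auto simp: s_def)
    also have "\<dots> \<le> exp (s * ?Y T) + exp (- s * ?Y T)"
      by (cases "?Y T \<ge> 0") auto
    finally show "(s * \<bar>?Y T\<bar>) ^ K / fact K \<le> exp (s * ?Y T) + exp (- s * ?Y T)" .
  qed auto
  also have "bern_mean q S (\<lambda>T. exp (s * ?Y T) + exp (- s * ?Y T)) =
     bern_mean q S (\<lambda>T. exp (s * ?Y T)) + bern_mean q S (\<lambda>T. exp (- s * ?Y T))"
    by (simp add: bern_mean_def distrib_left sum.distrib)
  also have "1 / 2 ^ K * \<dots> \<le> 1 / 2 ^ K * (exp (s\<^sup>2 * exp \<bar>s\<bar>) + exp ((-s)\<^sup>2 * exp \<bar>-s\<bar>))"
    by (intro mult_left_mono add_mono bern_mean_exp_le fin q a var) auto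
  also have "\<dots> = 2 / 2 ^ K * exp (4 * t\<^sup>2 * exp (2 * \<bar>t\<bar>))"
    by (simp add: s_def power_mult_distrib)
  finally show ?thesis .
qed

section \<open>Comparison of divisibility by small primes with the model\<close>

lemma exp_minus_bounds:
  fixes x :: real
  assumes "x \<ge> 0"
  shows "1 - x \<le> exp (- x)" "exp (- x) \<le> 1 - x + x\<^sup>2"
proof -
  show "1 - x \<le> exp (- x)" using exp_ge_add_one_self[of "-x"] by simp
  have "exp (- x) = inverse (exp x)" by (simp add: exp_minus)
  also have "\<dots> \<le> inverse (1 + x)"
    using assms exp_ge_add_one_self[of x] by (intro le_imp_inverse_le) auto
  also have "\<dots> \<le> 1 - x + x\<^sup>2"
    using assms by (simp add: field_simps power2_eq_square)
  finally show "exp (- x) \<le> 1 - x + x\<^sup>2" .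
qed

lemma exp_minus_diff_le:
  fixes x y :: real
  assumes "0 \<le> x" "x \<le> y"
  shows "\<bar>exp (- x) - exp (- y)\<bar> \<le> y - x"
proof -
  have "exp (- x) - exp (- y) = exp (- x) * (1 - exp (- (y - x)))"
    by (simp add: algebra_simps exp_add[symmetric])
  also have "\<dots> \<le> 1 * (y - x)"
    using assms exp_minus_bounds(1)[of "y - x"] by (intro mult_mono) auto
  finally show ?thesis using assms by simp
qed

text \<open>The Gaussian exponent has \<open>a\<^sup>2 * q\<close> in place of the variance
  \<open>a\<^sup>2 * q * (1 - q)\<close>, because \<open>B_sum\<close> normalises the former. The
  replacement costs the \<open>q\<^sup>2\<close> term, harmless since inverse squares of primes are
  summable; the other errors carry \<open>a\<^sup>2 * q\<close> and sum to O(\<epsilon>).\<close>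

lemma bern_char_factor:
  fixes a q t \<epsilon> :: real
  assumes q: "0 \<le> q" "q \<le> 1" and a: "\<bar>a\<bar> \<le> \<epsilon>" and \<epsilon>: "\<epsilon> \<le> 1"
  defines "F \<equiv> of_real q * iexp (t * (a * (1 - q))) + of_real (1 - q) * iexp (t * (- a * q))"
  shows "cmod F \<le> 1"
    and "cmod (F - of_real (exp (- (t\<^sup>2 / 2 * (a\<^sup>2 * q))))) \<le>
           (\<bar>t\<bar> ^ 3 + t ^ 4) * \<epsilon> * (a\<^sup>2 * q) + t\<^sup>2 * \<epsilon> * q\<^sup>2"
proof -
  have \<epsilon>0: "0 \<le> \<epsilon>" using a by linarith
  have "cmod F \<le> cmod (of_real q * iexp (t * (a * (1 - q)))) + cmod (of_real (1 - q) * iexp (t * (- a * q)))"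
    unfolding F_def by (rule norm_triangle_ineq)
  also have "\<dots> = 1" unfolding norm_mult norm_of_real norm_exp_i_times using q by simp
  finally show "cmod F \<le> 1" .
  \<comment> \<open>One centred Bernoulli variable as a two-point law on \<open>bool\<close>, in the
    form required by \<open>char_taylor\<close>.\<close>
  define w where "w b = (if b then q else 1 - q)" for b
  define X where "X b = (if b then a * (1 - q) else - a * q)" for b
  define x where "x = t\<^sup>2 / 2 * (a\<^sup>2 * q)"
  have \<epsilon>0': "0 \<le> t\<^sup>2 * (\<epsilon> * q\<^sup>2)" using \<epsilon>0 by simp
  have sq: "a\<^sup>2 \<le> \<epsilon>\<^sup>2" using a power_mono[of "\<bar>a\<bar>" \<epsilon> 2] by simp
  have \<epsilon>sq: "\<epsilon>\<^sup>2 \<le> \<epsilon>" using \<epsilon> \<epsilon>0 by (simp add: power2_eq_square mult_left_le)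
  have ch: "(\<Sum>b\<in>UNIV. w b * iexp (t * X b)) = F"
    by (simp add: UNIV_bool w_def X_def F_def)
  have "(\<Sum>b\<in>UNIV. w b * X b ^ 0) = 1" "(\<Sum>b\<in>UNIV. w b * X b ^ 1) = 0"
    "(\<Sum>b\<in>UNIV. w b * X b ^ 2) = a\<^sup>2 * q * (1 - q)"
    by (simp_all add: UNIV_bool w_def X_def power2_eq_square algebra_simps)
  moreover have atMost2: "{..2} = {0, 1, 2::nat}" by auto
  ultimately have tay: "(\<Sum>k\<le>2. (\<i> * t) ^ k / fact k * of_real (\<Sum>b\<in>UNIV. w b * X b ^ k)) =
        of_real (1 - t\<^sup>2 / 2 * (a\<^sup>2 * q * (1 - q)))"
    by (simp add: atMost2 power_mult_distrib del: of_real_sum)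
  have "cmod (F - of_real (1 - t\<^sup>2 / 2 * (a\<^sup>2 * q * (1 - q)))) \<le>
      \<bar>t\<bar> ^ Suc 2 / fact (Suc 2) * (\<Sum>b\<in>UNIV. w b * \<bar>X b\<bar> ^ Suc 2)"
    using char_taylor[of UNIV w t X 2] q unfolding ch tay by (auto simp: w_def)
  also have "\<dots> \<le> \<bar>t\<bar> ^ 3 / 1 * (\<epsilon> * (a\<^sup>2 * q))"
  proof (rule mult_mono)
    have "w b * \<bar>X b\<bar> ^ Suc 2 \<le> \<epsilon> * (w b * (X b)\<^sup>2)" for b
    proof -
      have "\<bar>X b\<bar> \<le> \<bar>a\<bar> * 1" unfolding X_def using q by (auto simp: abs_mult intro!: mult_left_le)
      hence "\<bar>X b\<bar> * (w b * (X b)\<^sup>2) \<le> \<epsilon> * (w b * (X b)\<^sup>2)"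
        using a q by (intro mult_right_mono) (auto simp: w_def)
      thus ?thesis by (simp only: power_Suc power2_abs mult_ac)
    qed
    hence "(\<Sum>b\<in>UNIV. w b * \<bar>X b\<bar> ^ Suc 2) \<le> (\<Sum>b\<in>UNIV. \<epsilon> * (w b * (X b)\<^sup>2))" by (rule sum_mono)
    also have "\<dots> = \<epsilon> * (a\<^sup>2 * q * (1 - q))"
      by (simp add: UNIV_bool w_def X_def power2_eq_square algebra_simps)
    also have "\<dots> \<le> \<epsilon> * (a\<^sup>2 * q)" using q \<epsilon>0 by (intro mult_left_mono mult_left_le) auto
    finally show "(\<Sum>b\<in>UNIV. w b * \<bar>X b\<bar> ^ Suc 2) \<le> \<epsilon> * (a\<^sup>2 * q)" .
    show "\<bar>t\<bar> ^ Suc 2 / fact (Suc 2) \<le> \<bar>t\<bar> ^ 3 / 1"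
    proof -
      have "\<bar>t\<bar> ^ 3 / fact 3 \<le> \<bar>t\<bar> ^ 3 / 1" by (intro divide_left_mono) (auto simp: fact_numeral)
      thus ?thesis by (simp add: eval_nat_numeral)
    qed
    show "0 \<le> (\<Sum>b\<in>UNIV. w b * \<bar>X b\<bar> ^ Suc 2)" using q by (intro sum_nonneg) (auto simp: w_def)
  qed simp
  finally have 1: "cmod (F - of_real (1 - t\<^sup>2 / 2 * (a\<^sup>2 * q * (1 - q)))) \<le> \<bar>t\<bar> ^ 3 * (\<epsilon> * (a\<^sup>2 * q))"
    by simp
  have x: "x \<ge> 0" using q by (simp add: x_def)
  have qq: "q\<^sup>2 \<le> q" using q by (simp add: power2_eq_square mult_left_le)
  have "x\<^sup>2 = t ^ 4 * (a\<^sup>2 * (a\<^sup>2 * q\<^sup>2)) / 4"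
    by (simp add: x_def power2_eq_square power4_eq_xxxx)
  also have "\<dots> \<le> t ^ 4 * (a\<^sup>2 * (a\<^sup>2 * q\<^sup>2))" using q by simp
  also have "\<dots> \<le> t ^ 4 * (\<epsilon> * (a\<^sup>2 * q))"
    using q qq sq \<epsilon>sq \<epsilon>0 by (intro mult_left_mono mult_mono) auto
  finally have x2: "x\<^sup>2 \<le> t ^ 4 * (\<epsilon> * (a\<^sup>2 * q))" .
  \<comment> \<open>This bounds the gap between \<open>a\<^sup>2 * q\<close> and the true
    variance.\<close>
  have "t\<^sup>2 / 2 * (a\<^sup>2 * q\<^sup>2) \<le> t\<^sup>2 / 1 * (\<epsilon> * q\<^sup>2)"
    using q sq \<epsilon>sq by (intro mult_mono mult_right_mono) auto
  moreover have "1 - t\<^sup>2 / 2 * (a\<^sup>2 * q * (1 - q)) - exp (- x) = (1 - x - exp (- x)) + t\<^sup>2 / 2 * (a\<^sup>2 * q\<^sup>2)"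
    by (simp add: x_def power2_eq_square algebra_simps)
  moreover have "t\<^sup>2 / 2 * (a\<^sup>2 * q\<^sup>2) \<ge> 0" by simp
  ultimately have "\<bar>1 - t\<^sup>2 / 2 * (a\<^sup>2 * q * (1 - q)) - exp (- x)\<bar> \<le> t ^ 4 * (\<epsilon> * (a\<^sup>2 * q)) + t\<^sup>2 * (\<epsilon> * q\<^sup>2)"
    using exp_minus_bounds[OF x] x2 \<epsilon>0' by linarith
  hence 2: "cmod (of_real (1 - t\<^sup>2 / 2 * (a\<^sup>2 * q * (1 - q))) - of_real (exp (- x))) \<le>
      t ^ 4 * (\<epsilon> * (a\<^sup>2 * q)) + t\<^sup>2 * (\<epsilon> * q\<^sup>2)"
    unfolding of_real_diff[symmetric] norm_of_real .
  from norm_triangle_ineq[of "F - of_real (1 - t\<^sup>2 / 2 * (a\<^sup>2 * q * (1 - q)))"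
      "of_real (1 - t\<^sup>2 / 2 * (a\<^sup>2 * q * (1 - q))) - of_real (exp (- x))"] 1 2
  show "cmod (F - of_real (exp (- (t\<^sup>2 / 2 * (a\<^sup>2 * q))))) \<le>
           (\<bar>t\<bar> ^ 3 + t ^ 4) * \<epsilon> * (a\<^sup>2 * q) + t\<^sup>2 * \<epsilon> * q\<^sup>2"
    unfolding x_def[symmetric] by (simp add: algebra_simps)
qed

text \<open>All factors have modulus at most 1, so the difference of the products is at most the sum
  of the differences. The last summand measures the variance missing from \<open>S\<close>, namely
  the part carried by large primes.\<close>

lemma bern_char_approx:
  fixes a q :: "'a \<Rightarrow> real" and t \<epsilon> :: real
  assumes fin: "finite S" and q: "\<And>p. p \<in> S \<Longrightarrow> 0 \<le> q p \<and> q p \<le> 1"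
    and a: "\<And>p. p \<in> S \<Longrightarrow> \<bar>a p\<bar> \<le> \<epsilon>" and \<epsilon>: "0 \<le> \<epsilon>" "\<epsilon> \<le> 1"
    and var: "(\<Sum>p\<in>S. (a p)\<^sup>2 * q p) \<le> 1" and q2: "(\<Sum>p\<in>S. (q p)\<^sup>2) \<le> 1"
  shows "cmod (bern_mean q S (\<lambda>T. iexp (t * centered_sum q a S T)) -
       of_real (exp (- (t\<^sup>2 / 2)))) \<le>
     (\<bar>t\<bar> ^ 3 + t ^ 4 + t\<^sup>2) * \<epsilon> + t\<^sup>2 / 2 * (1 - (\<Sum>p\<in>S. (a p)\<^sup>2 * q p))"
proof -
  let ?F = "\<lambda>p. of_real (q p) * iexp (t * (a p * (1 - q p))) + of_real (1 - q p) * iexp (t * (- a p * q p))"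
  let ?\<sigma> = "\<Sum>p\<in>S. (a p)\<^sup>2 * q p"
  have "bern_mean q S (\<lambda>T. iexp (t * centered_sum q a S T)) = (\<Prod>p\<in>S. ?F p)"
    using bern_mean_exp_centered_sum[OF fin, of q "\<i> * of_real t" a] by (simp add: mult.assoc)
  moreover have "complex_of_real (exp (- (t\<^sup>2 / 2 * ?\<sigma>))) = (\<Prod>p\<in>S. of_real (exp (- (t\<^sup>2 / 2 * ((a p)\<^sup>2 * q p)))))"
    unfolding of_real_prod[symmetric] exp_sum[OF fin, symmetric]
    by (simp only: sum_negf sum_distrib_left)
  moreover have "cmod ((\<Prod>p\<in>S. ?F p) - (\<Prod>p\<in>S. of_real (exp (- (t\<^sup>2 / 2 * ((a p)\<^sup>2 * q p))))))
     \<le> (\<Sum>p\<in>S. cmod (?F p - of_real (exp (- (t\<^sup>2 / 2 * ((a p)\<^sup>2 * q p))))))"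
  proof (rule norm_prod_diff)
    fix p assume p: "p \<in> S"
    show "cmod (?F p) \<le> 1" using q[OF p] a[OF p] \<epsilon> by (intro bern_char_factor(1)) auto
    show "cmod (of_real (exp (- (t\<^sup>2 / 2 * ((a p)\<^sup>2 * q p))))) \<le> 1"
      unfolding norm_of_real using q[OF p] by simp
  qed
  moreover have "\<dots> \<le> (\<Sum>p\<in>S. (\<bar>t\<bar> ^ 3 + t ^ 4) * \<epsilon> * ((a p)\<^sup>2 * q p) + t\<^sup>2 * \<epsilon> * (q p)\<^sup>2)"
    using q a \<epsilon> by (intro sum_mono bern_char_factor(2)) auto
  moreover have "\<dots> = (\<bar>t\<bar> ^ 3 + t ^ 4) * \<epsilon> * ?\<sigma> + t\<^sup>2 * \<epsilon> * (\<Sum>p\<in>S. (q p)\<^sup>2)"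
    by (simp add: sum.distrib sum_distrib_left)
  moreover have "\<dots> \<le> (\<bar>t\<bar> ^ 3 + t ^ 4) * \<epsilon> * 1 + t\<^sup>2 * \<epsilon> * 1"
    using \<epsilon> var q2 by (intro add_mono mult_left_mono) auto
  ultimately have 1: "cmod (bern_mean q S (\<lambda>T. iexp (t * centered_sum q a S T)) - of_real (exp (- (t\<^sup>2 / 2 * ?\<sigma>))))
     \<le> (\<bar>t\<bar> ^ 3 + t ^ 4 + t\<^sup>2) * \<epsilon>"
    by (simp add: algebra_simps)
  have "\<bar>exp (- (t\<^sup>2 / 2 * ?\<sigma>)) - exp (- (t\<^sup>2 / 2))\<bar> \<le> t\<^sup>2 / 2 - t\<^sup>2 / 2 * ?\<sigma>"
    using q var by (intro exp_minus_diff_le mult_nonneg_nonneg sum_nonneg) (auto simp: mult_left_le)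
  hence 2: "cmod (of_real (exp (- (t\<^sup>2 / 2 * ?\<sigma>))) - of_real (exp (- (t\<^sup>2 / 2)))) \<le> t\<^sup>2 / 2 * (1 - ?\<sigma>)"
    unfolding of_real_diff[symmetric] norm_of_real by (simp only: right_diff_distrib mult_1_right)
  from norm_triangle_ineq[of "bern_mean q S (\<lambda>T. iexp (t * centered_sum q a S T)) - of_real (exp (- (t\<^sup>2 / 2 * ?\<sigma>)))"
     "of_real (exp (- (t\<^sup>2 / 2 * ?\<sigma>))) - of_real (exp (- (t\<^sup>2 / 2)))"] 1 2
  show ?thesis by simp
qed

section \<open>Counting multiples, and comparison of moments\<close>

lemma real_nat_div_bounds:
  fixes n d :: nat
  shows "real n / real d - 1 \<le> real (n div d)" "real (n div d) \<le> real n / real d"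
proof -
  have "real_of_int \<lfloor>real n / real d\<rfloor> = real (n div d)"
    using floor_divide_of_nat_eq[of n d, where 'a = real] by simp
  thus "real n / real d - 1 \<le> real (n div d)" "real (n div d) \<le> real n / real d"
    using floor_correct[of "real n / real d"] by linarith+
qed

lemma card_multiples_atMost:
  fixes d n :: nat
  assumes "d > 0"
  shows "card {m \<in> {1..n}. d dvd m} = n div d"
proof -
  have "{m \<in> {1..n}. d dvd m} = (\<lambda>k. d * k) ` {1..n div d}"
  proof (intro equalityI subsetI)
    fix m assume "m \<in> {m \<in> {1..n}. d dvd m}"
    then obtain k where k: "m = d * k" "1 \<le> m" "m \<le> n" by (auto elim: dvdE)
    hence "k \<le> n div d" using assms by (simp add: less_eq_div_iff_mult_less_eq mult.commute)
    thus "m \<in> (\<lambda>k. d * k) ` {1..n div d}" using k by (auto simp: Suc_le_eq)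
  next
    fix m assume "m \<in> (\<lambda>k. d * k) ` {1..n div d}"
    thus "m \<in> {m \<in> {1..n}. d dvd m}"
      using assms by (auto simp: less_eq_div_iff_mult_less_eq mult.commute Suc_le_eq)
  qed
  moreover have "inj_on (\<lambda>k. d * k) {1..n div d}" using assms by (auto simp: inj_on_def)
  ultimately show ?thesis by (simp add: card_image)
qed

lemma prod_primes_dvd_iff:
  fixes m :: nat
  assumes "finite U" "\<And>p. p \<in> U \<Longrightarrow> prime p"
  shows "\<Prod>U dvd m \<longleftrightarrow> (\<forall>p\<in>U. p dvd m)"
proof
  assume "\<Prod>U dvd m"
  thus "\<forall>p\<in>U. p dvd m" using assms by (meson dvd_prodI dvd_trans)
next
  assume "\<forall>p\<in>U. p dvd m"
  with assms show "\<Prod>U dvd m"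
  proof (induction U rule: finite_induct)
    case (insert p U)
    have "coprime p (\<Prod>U)"
      using insert by (intro prod_coprime_right) (metis insert_iff primes_coprime)
    thus ?case using insert by (simp add: divides_mult)
  qed simp
qed

text \<open>
  The indicator of U \<subseteq> T makes the induction on k work: multiplying it by the indicator of p \<in> T
  gives the indicator of insert p U \<subseteq> T.
\<close>

lemma moment_diff_le:
  fixes S :: "nat set" and c :: "nat \<Rightarrow> real" and b :: real and n :: nat
  assumes fin: "finite S" and prime: "\<And>p. p \<in> S \<Longrightarrow> prime p" and n: "n \<ge> 1"
    and U: "U \<subseteq> S"
  defines "D \<equiv> \<lambda>F. (\<Sum>m=1..n. 1 / real n * F {p \<in> S. p dvd m}) - bern_mean (\<lambda>p. 1 / real p) S F"
  shows "\<bar>D (\<lambda>T. ((\<Sum>p\<in>S. c p * (if p \<in> T then 1 else 0)) + b) ^ k * (if U \<subseteq> T then 1 else 0))\<bar>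
       \<le> ((\<Sum>p\<in>S. \<bar>c p\<bar>) + \<bar>b\<bar>) ^ k / real n"
  using U
proof (induction k arbitrary: U)
  case 0
  have finU: "finite U" using fin 0 finite_subset by auto
  have pU: "prime p" if "p \<in> U" for p using that prime 0 by auto
  have pos: "\<Prod>U > 0" using pU by (auto intro!: prod_pos simp: prime_gt_0_nat)
  \<comment> \<open>The event is divisibility by \<open>\<Prod>U\<close>, so the base case is only
    the rounding error of a quotient: at most 1, hence \<open>1 / n\<close> after averaging.\<close>
  have "(\<Sum>m=1..n. if U \<subseteq> {p \<in> S. p dvd m} then 1 else 0) = real (card {m \<in> {1..n}. \<Prod>U dvd m})"
    using prod_primes_dvd_iff[OF finU pU] 0 by (subst sum.inter_filter[symmetric]) (auto intro!: arg_cong[where f = card])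
  also have "\<dots> = real (n div \<Prod>U)" by (simp only: card_multiples_atMost[OF pos])
  finally have 1: "(\<Sum>m=1..n. 1 / real n * (if U \<subseteq> {p \<in> S. p dvd m} then 1 else 0)) = real (n div \<Prod>U) / real n"
    by (simp only: sum_distrib_left[symmetric]) simp
  have 2: "bern_mean (\<lambda>p. 1 / real p) S (\<lambda>T. if U \<subseteq> T then 1 else 0) = 1 / real (\<Prod>U)"
    using bern_mean_subset[OF fin 0, of "\<lambda>p. 1 / real p", where 'b = real] by (simp add: prod_dividef)
  have "real n / real (\<Prod>U) - 1 \<le> real (n div \<Prod>U)" "real (n div \<Prod>U) \<le> real n / real (\<Prod>U)"
    by (rule real_nat_div_bounds)+
  hence "\<bar>real (n div \<Prod>U) - real n / real (\<Prod>U)\<bar> \<le> 1" by linarith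
  moreover have eq: "real (n div \<Prod>U) / real n - 1 / real (\<Prod>U) = (real (n div \<Prod>U) - real n / real (\<Prod>U)) / real n"
    using n by (simp add: diff_divide_distrib del: of_nat_prod)
  ultimately have "\<bar>real (n div \<Prod>U) / real n - 1 / real (\<Prod>U)\<bar> \<le> 1 / real n"
    using eq n by (simp add: divide_right_mono del: of_nat_prod)
  thus ?case using 1 2 by (simp add: D_def)
next
  case (Suc k)
  let ?L = "\<lambda>T. (\<Sum>p\<in>S. c p * (if p \<in> T then 1 else 0)) + b"
  let ?I = "\<lambda>U T. if U \<subseteq> T then 1 else (0::real)"
  let ?W = "(\<Sum>p\<in>S. \<bar>c p\<bar>) + \<bar>b\<bar>"
  have D_add: "D (\<lambda>T. F T + G T) = D F + D G" for F G
    by (simp add: D_def bern_mean_def distrib_left sum.distrib add_divide_distrib)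
  have D_cmult: "D (\<lambda>T. x * F T) = x * D F" for x F
    by (simp add: D_def bern_mean_def sum_distrib_left right_diff_distrib mult_ac)
  have D_sum: "D (\<lambda>T. \<Sum>p\<in>S. F p T) = (\<Sum>p\<in>S. D (F p))" for F :: "nat \<Rightarrow> nat set \<Rightarrow> real"
    unfolding D_def bern_mean_def sum_distrib_left sum_subtractf by (intro arg_cong2[where f = "(-)"] sum.swap)
  have "?L T ^ Suc k * ?I U T = (\<Sum>p\<in>S. c p * (?L T ^ k * ?I (insert p U) T)) + b * (?L T ^ k * ?I U T)" for T
    by (auto simp: algebra_simps sum_distrib_left sum_distrib_right intro!: sum.cong)
  hence eq: "D (\<lambda>T. ?L T ^ Suc k * ?I U T) =
      (\<Sum>p\<in>S. c p * D (\<lambda>T. ?L T ^ k * ?I (insert p U) T)) + b * D (\<lambda>T. ?L T ^ k * ?I U T)"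
    by (simp only: D_add D_cmult D_sum)
  have le: "\<bar>(\<Sum>p\<in>S. c p * D (\<lambda>T. ?L T ^ k * ?I (insert p U) T)) + b * D (\<lambda>T. ?L T ^ k * ?I U T)\<bar> \<le> (\<Sum>p\<in>S. \<bar>c p\<bar> * (?W ^ k / n)) + \<bar>b\<bar> * (?W ^ k / n)"
  proof (rule order_trans[OF abs_triangle_ineq], rule add_mono)
    show "\<bar>\<Sum>p\<in>S. c p * D (\<lambda>T. ?L T ^ k * ?I (insert p U) T)\<bar> \<le> (\<Sum>p\<in>S. \<bar>c p\<bar> * (?W ^ k / n))"
    proof (rule order_trans[OF sum_abs], rule sum_mono)
      fix p assume "p \<in> S"
      hence "insert p U \<subseteq> S" using Suc.prems by simp
      thus "\<bar>c p * D (\<lambda>T. ?L T ^ k * ?I (insert p U) T)\<bar> \<le> \<bar>c p\<bar> * (?W ^ k / n)"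
        unfolding abs_mult by (intro mult_left_mono Suc.IH) auto
    qed
    show "\<bar>b * D (\<lambda>T. ?L T ^ k * ?I U T)\<bar> \<le> \<bar>b\<bar> * (?W ^ k / n)"
      unfolding abs_mult by (intro mult_left_mono Suc.IH Suc.prems) auto
  qed
  have "?W ^ Suc k / n = (\<Sum>p\<in>S. \<bar>c p\<bar> * (?W ^ k / n)) + \<bar>b\<bar> * (?W ^ k / n)"
    by (simp only: sum_distrib_right[symmetric] distrib_right[symmetric] power_Suc times_divide_eq_right[symmetric] mult.assoc)
  with le show ?case by (simp only: eq)
qed

lemma centered_moment_diff_le:
  fixes S :: "nat set" and n :: nat
  assumes fin: "finite S" and prime: "\<And>p. p \<in> S \<Longrightarrow> prime p" and n: "n \<ge> 1"
    and a: "\<And>p. p \<in> S \<Longrightarrow> \<bar>a p\<bar> \<le> 1" and k: "k \<le> K"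
  defines "q \<equiv> \<lambda>p. 1 / real p"
  shows "\<bar>(\<Sum>m=1..n. 1 / real n * centered_sum q a S {p \<in> S. p dvd m} ^ k) -
       bern_mean q S (\<lambda>T. centered_sum q a S T ^ k)\<bar> \<le> (1 + 2 * real (card S)) ^ K / real n"
proof -
  have cs: "centered_sum q a S T = (\<Sum>p\<in>S. a p * (if p \<in> T then 1 else 0)) + (- (\<Sum>p\<in>S. a p * q p))" for T
    by (simp add: centered_sum_def right_diff_distrib sum_subtractf)
  let ?W = "(\<Sum>p\<in>S. \<bar>a p\<bar>) + \<bar>- (\<Sum>p\<in>S. a p * q p)\<bar>"
  have "\<bar>- (\<Sum>p\<in>S. a p * q p)\<bar> \<le> (\<Sum>p\<in>S. \<bar>a p\<bar> * q p)"
    unfolding abs_minus_cancel by (rule order_trans[OF sum_abs]) (auto simp: abs_mult q_def intro!: sum_mono)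
  also have "\<dots> \<le> (\<Sum>p\<in>S. 1 * 1)"
    using a prime by (intro sum_mono mult_mono) (auto simp: q_def divide_le_eq dest!: prime_gt_0_nat)
  finally have 1: "\<bar>- (\<Sum>p\<in>S. a p * q p)\<bar> \<le> real (card S)" by simp
  have 2: "(\<Sum>p\<in>S. \<bar>a p\<bar>) \<le> real (card S)" using sum_mono[of S "\<lambda>p. \<bar>a p\<bar>" "\<lambda>_. 1"] a by simp
  have "?W ^ k \<le> (1 + 2 * real (card S)) ^ k"
    using 1 2 by (intro power_mono) (auto intro!: add_nonneg_nonneg sum_nonneg)
  \<comment> \<open>The summand 1 keeps the base at least 1 even for empty \<open>S\<close>, so the
    exponent may be raised.\<close>
  also have "\<dots> \<le> (1 + 2 * real (card S)) ^ K" using k by (intro power_increasing) auto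
  finally have "?W ^ k / n \<le> (1 + 2 * real (card S)) ^ K / n" by (intro divide_right_mono) auto
  thus ?thesis
    using moment_diff_le[OF fin prime n, of "{}" a "- (\<Sum>p\<in>S. a p * q p)" k]
    unfolding cs[symmetric] q_def[symmetric] by simp
qed

section \<open>Inverse squares, large primes and small primes\<close>

text \<open>Telescoping proves the sharper bound \<open>1 / D - 1 / N\<close>. The case
  \<open>D = 1\<close> handles the squared probabilities of the model, general \<open>D\<close> the
  integers with a large square divisor.\<close>

lemma sum_inverse_squares_le:
  assumes "D \<ge> 1"
  shows "(\<Sum>d\<in>{D<..N}. 1 / (real d)\<^sup>2) \<le> 1 / real D"
proof (cases "D \<le> N")
  case True
  have "(\<Sum>d\<in>{D<..N}. 1 / (real d)\<^sup>2) \<le> 1 / real D - 1 / real N"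
    using True
  proof (induction N rule: dec_induct)
    case (step N)
    have N: "real N > 0" using step assms by simp
    have "{D<..Suc N} = insert (Suc N) {D<..N}" using step by auto
    hence "(\<Sum>d\<in>{D<..Suc N}. 1 / (real d)\<^sup>2) = 1 / (real (Suc N))\<^sup>2 + (\<Sum>d\<in>{D<..N}. 1 / (real d)\<^sup>2)" by simp
    also have "1 / (real (Suc N))\<^sup>2 \<le> 1 / (real N * real (Suc N))"
      unfolding power2_eq_square using N by (intro divide_left_mono mult_right_mono) auto
    also have "\<dots> = 1 / real N - 1 / real (Suc N)" using N by (simp add: field_simps)
    finally show ?case using step by simp
  qed simp
  thus ?thesis by (smt (verit) divide_nonneg_nonneg of_nat_0_le_iff)
qed simp

text \<open>The product of these primes divides \<open>m\<close>, so its \<open>u\<close>-th power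
  is at most \<open>n ^ u\<close>, while each prime contributes a factor exceeding \<open>n\<close>
  to it.\<close>

lemma card_large_prime_divisors_le:
  fixes n m u :: nat
  assumes "1 \<le> m" "m \<le> n"
  shows "card {p. prime p \<and> p dvd m \<and> n < p ^ u} \<le> u"
proof -
  let ?L = "{p. prime p \<and> p dvd m \<and> n < p ^ u}"
  have fin: "finite ?L"
    using assms by (intro finite_subset[OF _ finite_divisors_nat[of m]]) auto
  have "\<Prod>?L dvd m" using prod_primes_dvd_iff[OF fin, of m] by auto
  hence le: "\<Prod>?L \<le> m" using assms by (intro dvd_imp_le) auto
  have "n ^ card ?L = (\<Prod>p\<in>?L. n)" by simp
  also have "\<dots> \<le> (\<Prod>p\<in>?L. p ^ u)" by (intro prod_mono) auto
  also have "\<dots> = (\<Prod>?L) ^ u" by (simp add: prod_power_distrib)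
  also have "\<dots> \<le> n ^ u" using le assms by (intro power_mono) auto
  finally have "n ^ card ?L \<le> n ^ u" .
  \<comment> \<open>Powers of 1 do not determine the exponent, but then \<open>m = 1\<close> has no
    prime divisors.\<close>
  moreover have "?L = {}" if "n = 1" using that assms by (auto dest: prime_gt_1_nat)
  hence "card ?L = 0" if "n = 1" using that by (simp only: card.empty)
  ultimately show ?thesis
  proof (cases "n = 1")
    case False
    with \<open>n ^ card ?L \<le> n ^ u\<close> assms show ?thesis by simp
  qed linarith
qed

text \<open>Double counting of pairs of a large prime and a multiple of it up to \<open>n\<close>:
  each \<open>m\<close> lies in at most \<open>u\<close> pairs.\<close>

lemma sum_large_primes_le:
  fixes n u :: nat
  shows "(\<Sum>p | prime p \<and> p \<le> n \<and> n < p ^ u. 1 / real p) \<le> 2 * real u"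
proof (cases "n = 0")
  case False
  let ?L = "{p. prime p \<and> p \<le> n \<and> n < p ^ u}"
  have fin: "finite ?L" by (rule finite_subset[of _ "{..n}"]) auto
  have "real n * (\<Sum>p\<in>?L. 1 / real p) \<le> (\<Sum>p\<in>?L. 2 * real (n div p))"
    unfolding sum_distrib_left
  proof (rule sum_mono)
    fix p assume p: "p \<in> ?L"
    hence p0: "p > 0" by (auto dest: prime_gt_0_nat)
    \<comment> \<open>Since \<open>p \<le> n\<close>, the quotient is at least 1, so the loss of 1
      by rounding at most halves it; hence the factor 2.\<close>
    have "1 \<le> n div p" using p p0 by (simp add: less_eq_div_iff_mult_less_eq)
    moreover have "real n / real p - 1 \<le> real (n div p)" by (rule real_nat_div_bounds)
    ultimately show "real n * (1 / real p) \<le> 2 * real (n div p)" by simp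
  qed
  also have "\<dots> = 2 * real (\<Sum>p\<in>?L. card {m \<in> {1..n}. p dvd m})"
    unfolding of_nat_sum sum_distrib_left
    by (intro sum.cong refl arg_cong2[where f = "(*)"] arg_cong[where f = real] card_multiples_atMost[symmetric])
       (auto dest: prime_gt_0_nat)
  also have "(\<Sum>p\<in>?L. card {m \<in> {1..n}. p dvd m}) = (\<Sum>p\<in>?L. \<Sum>m\<in>{1..n}. if p dvd m then 1 else 0)"
    by (simp add: sum.inter_filter[symmetric] del: One_nat_def)
  also have "\<dots> = (\<Sum>m\<in>{1..n}. \<Sum>p\<in>?L. if p dvd m then 1 else 0)" by (rule sum.swap)
  also have "\<dots> = (\<Sum>m\<in>{1..n}. card {p \<in> ?L. p dvd m})"
    using fin by (simp add: sum.inter_filter[symmetric] del: One_nat_def)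
  also have "\<dots> \<le> (\<Sum>m\<in>{1..n}. u)"
  proof (rule sum_mono)
    fix m assume m: "m \<in> {1..n}"
    have "finite {p. prime p \<and> p dvd m \<and> n < p ^ u}"
      using m by (intro finite_subset[OF _ finite_divisors_nat[of m]]) auto
    hence "card {p \<in> ?L. p dvd m} \<le> card {p. prime p \<and> p dvd m \<and> n < p ^ u}" by (rule card_mono) auto
    also have "\<dots> \<le> u" using m by (intro card_large_prime_divisors_le) auto
    finally show "card {p \<in> ?L. p dvd m} \<le> u" .
  qed
  finally have "real n * (\<Sum>p\<in>?L. 1 / real p) \<le> real n * (2 * real u)" by simp
  thus ?thesis using False by simp
next
  case True
  hence no_primes: "{p. prime p \<and> p \<le> n \<and> n < p ^ u} = {}" by auto
  show ?thesis unfolding no_primes by simp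
qed

text \<open>A set of positive integers has at most as many elements as its maximum, and the maximum
  lies in the set; this avoids taking a \<open>u\<close>-th root of \<open>n\<close>.\<close>

lemma card_small_primes_power_le:
  fixes n u :: nat
  assumes "n \<ge> 1"
  shows "card {p. prime p \<and> p ^ u \<le> n \<and> p \<le> n} ^ u \<le> n"
proof (cases "{p. prime p \<and> p ^ u \<le> n \<and> p \<le> n} = {}")
  case True
  \<comment> \<open>For \<open>u = 0\<close> the left side is \<open>0 ^ 0 = 1\<close>, where
    \<open>n \<ge> 1\<close> enters.\<close>
  show ?thesis unfolding True using assms by (cases u) auto
next
  case False
  let ?S = "{p. prime p \<and> p ^ u \<le> n \<and> p \<le> n}"
  have fin: "finite ?S" by (rule finite_subset[of _ "{..n}"]) auto
  have "?S \<subseteq> {1..Max ?S}" using fin by (auto intro!: Max_ge prime_ge_1_nat simp del: One_nat_def)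
  hence "card ?S \<le> Max ?S" using card_mono[of "{1..Max ?S}" ?S] by simp
  hence "card ?S ^ u \<le> Max ?S ^ u" by (intro power_mono) auto
  also have "\<dots> \<le> n" using Max_in[OF fin False] by auto
  finally show ?thesis .
qed

section \<open>Convergence of characteristic functions\<close>

lemma cmod_iexp_diff_le: "cmod (iexp x - iexp y) \<le> \<bar>x - y\<bar>"
proof -
  have "iexp x - iexp y = iexp y * (iexp (x - y) - 1)"
    by (simp add: algebra_simps exp_add[symmetric])
  hence "cmod (iexp x - iexp y) = cmod (iexp (x - y) - 1)"
    by (simp only: norm_mult norm_exp_i_times mult_1_left)
  also have "\<dots> \<le> \<bar>x - y\<bar>" using iexp_approx1[of "x - y" 0] by simp
  finally show ?thesis .
qed

lemma power_div_le_inverse_sqrt: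
  fixes c n K :: nat
  assumes n: "n \<ge> 1" and c: "c ^ (2 * K) \<le> n"
  shows "(1 + 2 * real c) ^ K / real n \<le> 3 ^ K / sqrt (real n)"
proof -
  \<comment> \<open>The maximum with 1 gives \<open>1 + 2 * c \<le> 3 * e\<close> also for
    \<open>c = 0\<close>.\<close>
  define e where "e = max 1 c"
  have "e ^ (2 * K) \<le> n" using n c by (auto simp: e_def max_def)
  hence "(real e ^ K)\<^sup>2 \<le> real n"
    by (metis of_nat_le_iff of_nat_power power_mult mult.commute)
  hence eK: "real e ^ K \<le> sqrt (real n)" by (rule real_le_rsqrt)
  have "(1 + 2 * real c) ^ K \<le> (3 * real e) ^ K"
    by (intro power_mono) (auto simp: e_def)
  also have "\<dots> \<le> 3 ^ K * sqrt (real n)"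
    using eK by (simp add: power_mult_distrib)
  finally have "(1 + 2 * real c) ^ K / real n \<le> 3 ^ K * sqrt (real n) / real n"
    by (intro divide_right_mono) auto
  also have "\<dots> = 3 ^ K / sqrt (real n)"
    using n by (simp add: real_div_sqrt field_simps)
  finally show ?thesis .
qed

text \<open>Three replacements: \<open>Z\<close> by its part \<open>X\<close> over small primes (the
  term with 6 K), \<open>X\<close> by the model (the terms with \<open>sqrt n\<close> and
  \<open>2 ^ K\<close>), and the model by the normal law (the remaining multiples of \<epsilon>).
  Keeping \<open>K\<close> and \<open>n\<close> separate allows \<open>n\<close> to tend to infinity
  first.\<close>

lemma uniform_char_estimate:
  fixes n K :: nat and a :: "nat \<Rightarrow> real" and t \<epsilon> :: real
  assumes n: "n \<ge> 1" and K: "even K" "K > 0"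
    and a: "\<And>p. prime p \<Longrightarrow> p \<le> n \<Longrightarrow> \<bar>a p\<bar> \<le> \<epsilon>" and \<epsilon>: "0 \<le> \<epsilon>" "\<epsilon> \<le> 1"
    and var: "(\<Sum>p | prime p \<and> p \<le> n. (a p)\<^sup>2 * (1 / real p)) = 1"
  defines "Z \<equiv> \<lambda>m. \<Sum>p | prime p \<and> p \<le> n. a p * ((if p dvd m then 1 else 0) - 1 / real p)"
  shows "cmod ((\<Sum>m=1..n. of_real (1 / real n) * iexp (t * Z m)) - of_real (exp (- (t\<^sup>2 / 2)))) \<le>
    3 ^ K / sqrt (real n) * exp \<bar>t\<bar> + 4 / 2 ^ K * exp (4 * t\<^sup>2 * exp (2 * \<bar>t\<bar>)) +
    ((\<bar>t\<bar> ^ 3 + t ^ 4 + t\<^sup>2) + t\<^sup>2 / 2 * (4 * real K) + \<bar>t\<bar> * (6 * real K)) * \<epsilon>"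
proof -
  define u where "u = 2 * K"
  define S where "S = {p. prime p \<and> p ^ u \<le> n \<and> p \<le> n}"
  define L where "L = {p. prime p \<and> p \<le> n \<and> n < p ^ u}"
  define q where "q = (\<lambda>p::nat. 1 / real p)"
  define X where "X m = centered_sum q a S {p \<in> S. p dvd m}" for m
  have fin: "finite S" "finite L" by (rule finite_subset[of _ "{..n}"]; auto simp: S_def L_def)+
  have split: "{p. prime p \<and> p \<le> n} = S \<union> L" "S \<inter> L = {}" by (auto simp: S_def L_def)
  have prS: "prime p" if "p \<in> S" for p using that by (auto simp: S_def)
  have q: "0 \<le> q p \<and> q p \<le> 1" if "p \<in> S" for p
    using prime_ge_1_nat[OF prS[OF that]] by (simp add: q_def)
  have aS: "\<bar>a p\<bar> \<le> \<epsilon>" if "p \<in> S" for p using that a by (auto simp: S_def)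
  have aL: "\<bar>a p\<bar> \<le> \<epsilon>" if "p \<in> L" for p using that a by (auto simp: L_def)
  have sumL: "(\<Sum>p\<in>L. q p) \<le> 2 * real u"
    using sum_large_primes_le[of n u] by (simp add: L_def q_def)
  have varSL: "(\<Sum>p\<in>S. (a p)\<^sup>2 * q p) + (\<Sum>p\<in>L. (a p)\<^sup>2 * q p) = 1"
    using var fin split(2) unfolding split(1) q_def by (simp add: sum.union_disjoint)
  have "(\<Sum>p\<in>L. (a p)\<^sup>2 * q p) \<le> (\<Sum>p\<in>L. \<epsilon> * q p)"
  proof (rule sum_mono)
    fix p assume "p \<in> L"
    hence "(a p)\<^sup>2 \<le> \<epsilon>\<^sup>2" using aL[of p] power_mono[of "\<bar>a p\<bar>" \<epsilon> 2] by simp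
    also have "\<dots> \<le> \<epsilon>" using \<epsilon> by (simp add: power2_eq_square mult_left_le)
    finally show "(a p)\<^sup>2 * q p \<le> \<epsilon> * q p" by (intro mult_right_mono) (auto simp: q_def)
  qed
  also have "\<dots> \<le> \<epsilon> * (2 * real u)"
    unfolding sum_distrib_left[symmetric] using sumL \<epsilon> by (intro mult_left_mono) auto
  finally have varL: "1 - (\<Sum>p\<in>S. (a p)\<^sup>2 * q p) \<le> \<epsilon> * (4 * real K)"
    using varSL by (simp add: u_def)
  have "0 \<le> (\<Sum>p\<in>L. (a p)\<^sup>2 * q p)" by (intro sum_nonneg) (auto simp: q_def)
  hence varS: "(\<Sum>p\<in>S. (a p)\<^sup>2 * q p) \<le> 1" using varSL by linarith
  \<comment> \<open>The sum over primes is dominated by the sum over all integers greater than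
    1.\<close>
  have "(\<Sum>p\<in>S. (q p)\<^sup>2) \<le> (\<Sum>d\<in>{1<..n}. 1 / (real d)\<^sup>2)"
    unfolding q_def power_divide power_one
    by (intro sum_mono2) (auto simp: S_def prime_gt_1_nat simp del: One_nat_def)
  also have "\<dots> \<le> 1" using sum_inverse_squares_le[of 1 n] by simp
  finally have q2: "(\<Sum>p\<in>S. (q p)\<^sup>2) \<le> 1" .

  have ZX: "\<bar>Z m - X m\<bar> \<le> 6 * real K * \<epsilon>" if m: "m \<in> {1..n}" for m
  proof -
    have "X m = (\<Sum>p\<in>S. a p * ((if p dvd m then 1 else 0) - 1 / real p))"
      unfolding X_def centered_sum_def q_def by (intro sum.cong) auto
    hence "Z m - X m = (\<Sum>p\<in>L. a p * ((if p dvd m then 1 else 0) - 1 / real p))"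
      using fin split(2) unfolding Z_def split(1) by (simp add: sum.union_disjoint)
    also have "\<bar>\<dots>\<bar> \<le> (\<Sum>p\<in>L. \<epsilon> * ((if p dvd m then 1 else 0) + q p))"
    proof (rule order_trans[OF sum_abs], rule sum_mono)
      fix p assume "p \<in> L"
      moreover have "\<bar>(if p dvd m then 1 else 0) - 1 / real p\<bar> \<le> (if p dvd m then 1 else 0) + q p"
        using abs_triangle_ineq4[of "if p dvd m then 1 else 0" "1 / real p"] by (auto simp: q_def)
      ultimately show "\<bar>a p * ((if p dvd m then 1 else 0) - 1 / real p)\<bar> \<le> \<epsilon> * ((if p dvd m then 1 else 0) + q p)"
        unfolding abs_mult using aL \<epsilon> by (intro mult_mono) auto
    qed
    also have "\<dots> = \<epsilon> * (real (card {p \<in> L. p dvd m}) + (\<Sum>p\<in>L. q p))"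
      unfolding sum_distrib_left[symmetric] sum.distrib using fin(2) by (simp add: sum.inter_filter[symmetric])
    \<comment> \<open>At most \<open>u\<close> large primes divide \<open>m\<close>, and the
      centring terms add at most \<open>2 * u\<close>; with \<open>u = 2 * K\<close> the total is 6
      K.\<close>
    also have "\<dots> \<le> \<epsilon> * (real u + 2 * real u)"
    proof (intro mult_left_mono add_mono sumL \<epsilon>)
      have "finite {p. prime p \<and> p dvd m \<and> n < p ^ u}"
        using m by (intro finite_subset[OF _ finite_divisors_nat[of m]]) auto
      hence "card {p \<in> L. p dvd m} \<le> card {p. prime p \<and> p dvd m \<and> n < p ^ u}"
        by (rule card_mono) (auto simp: L_def)
      also have "\<dots> \<le> u" using m by (intro card_large_prime_divisors_le) auto
      finally show "real (card {p \<in> L. p dvd m}) \<le> real u" by simp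
    qed
    finally show ?thesis by (simp add: u_def algebra_simps)
  qed
  let ?\<phi>Z = "\<Sum>m=1..n. of_real (1 / real n) * iexp (t * Z m)"
  let ?\<phi>X = "\<Sum>m=1..n. of_real (1 / real n) * iexp (t * X m)"
  let ?\<phi>Y = "bern_mean q S (\<lambda>T. iexp (t * centered_sum q a S T))"
  have "?\<phi>Z - ?\<phi>X = (\<Sum>m=1..n. of_real (1 / real n) * (iexp (t * Z m) - iexp (t * X m)))"
    by (simp only: sum_subtractf right_diff_distrib)
  also have "cmod \<dots> \<le> (\<Sum>m=1..n. 1 / real n * (\<bar>t\<bar> * (6 * real K * \<epsilon>)))"
  proof (rule sum_norm_le)
    fix m assume m: "m \<in> {1..n}"
    have "cmod (iexp (t * Z m) - iexp (t * X m)) \<le> \<bar>t * Z m - t * X m\<bar>" by (rule cmod_iexp_diff_le)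
    also have "\<dots> = \<bar>t\<bar> * \<bar>Z m - X m\<bar>" by (simp only: abs_mult right_diff_distrib[symmetric])
    also have "\<dots> \<le> \<bar>t\<bar> * (6 * real K * \<epsilon>)" using ZX[OF m] by (intro mult_left_mono) auto
    finally show "cmod (of_real (1 / real n) * (iexp (t * Z m) - iexp (t * X m))) \<le> 1 / real n * (\<bar>t\<bar> * (6 * real K * \<epsilon>))"
      unfolding norm_mult norm_of_real by (intro mult_mono) auto
  qed
  also have "\<dots> = \<bar>t\<bar> * (6 * real K * \<epsilon>)" using n by simp
  finally have 1: "cmod (?\<phi>Z - ?\<phi>X) \<le> \<bar>t\<bar> * (6 * real K * \<epsilon>)" .

  have card: "card S ^ (2 * K) \<le> n"
    using card_small_primes_power_le[OF n, of u] unfolding S_def u_def .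
  have "cmod (?\<phi>X - ?\<phi>Y) \<le> (1 + 2 * real (card S)) ^ K / real n * exp \<bar>t\<bar> +
     2 * (\<bar>t\<bar> ^ K / fact K * bern_mean q S (\<lambda>T. centered_sum q a S T ^ K))"
    unfolding bern_mean_real unfolding bern_mean_def
  proof (rule char_diff_le_moments)
    show "0 \<le> bern_weight q S T" if "T \<in> Pow S" for T using that q by (intro bern_weight_nonneg) auto
    show "\<bar>(\<Sum>m=1..n. 1 / real n * X m ^ k) - (\<Sum>T\<in>Pow S. bern_weight q S T * centered_sum q a S T ^ k)\<bar>
        \<le> (1 + 2 * real (card S)) ^ K / real n" if "k \<le> K" for k
      using centered_moment_diff_le[OF fin(1) prS n _ that, of a] aS \<epsilon>
      unfolding X_def q_def[symmetric] bern_mean_real by force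
  qed (use K in auto)
  also have "\<dots> \<le> 3 ^ K / sqrt (real n) * exp \<bar>t\<bar> + 2 * (2 / 2 ^ K * exp (4 * t\<^sup>2 * exp (2 * \<bar>t\<bar>)))"
    using aS \<epsilon> by (intro add_mono mult_left_mono mult_right_mono power_div_le_inverse_sqrt[OF n card]
        bern_mean_moment_le fin q varS K) (auto intro: order_trans)
  finally have 2: "cmod (?\<phi>X - ?\<phi>Y) \<le> 3 ^ K / sqrt (real n) * exp \<bar>t\<bar> + 4 / 2 ^ K * exp (4 * t\<^sup>2 * exp (2 * \<bar>t\<bar>))"
    by simp
  have "cmod (?\<phi>Y - of_real (exp (- (t\<^sup>2 / 2)))) \<le>
     (\<bar>t\<bar> ^ 3 + t ^ 4 + t\<^sup>2) * \<epsilon> + t\<^sup>2 / 2 * (1 - (\<Sum>p\<in>S. (a p)\<^sup>2 * q p))"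
    by (intro bern_char_approx fin q aS \<epsilon> varS q2)
  also have "\<dots> \<le> (\<bar>t\<bar> ^ 3 + t ^ 4 + t\<^sup>2) * \<epsilon> + t\<^sup>2 / 2 * (\<epsilon> * (4 * real K))"
    using varL by (intro add_left_mono mult_left_mono) auto
  finally have 3: "cmod (?\<phi>Y - of_real (exp (- (t\<^sup>2 / 2)))) \<le>
     (\<bar>t\<bar> ^ 3 + t ^ 4 + t\<^sup>2) * \<epsilon> + t\<^sup>2 / 2 * (\<epsilon> * (4 * real K))" .
  have tri: "cmod (x - w) \<le> cmod (x - y) + (cmod (y - z) + cmod (z - w))" for x y z w
    using norm_triangle_ineq[of "x - y" "y - w"] norm_triangle_ineq[of "y - z" "z - w"] by simp
  have "cmod (?\<phi>Z - of_real (exp (- (t\<^sup>2 / 2)))) \<le> \<bar>t\<bar> * (6 * real K * \<epsilon>) +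
      ((3 ^ K / sqrt (real n) * exp \<bar>t\<bar> + 4 / 2 ^ K * exp (4 * t\<^sup>2 * exp (2 * \<bar>t\<bar>))) +
       ((\<bar>t\<bar> ^ 3 + t ^ 4 + t\<^sup>2) * \<epsilon> + t\<^sup>2 / 2 * (\<epsilon> * (4 * real K))))"
    by (rule order_trans[OF tri[of _ _ ?\<phi>X ?\<phi>Y]]) (intro add_mono 1 2 3)
  thus ?thesis by (simp only: algebra_simps)
qed

lemma uniform_char_tendsto:
  fixes a :: "nat \<Rightarrow> nat \<Rightarrow> real" and \<epsilon> :: "nat \<Rightarrow> real" and t :: real
  assumes a: "\<forall>\<^sub>F n in sequentially. \<forall>p. prime p \<longrightarrow> p \<le> n \<longrightarrow> \<bar>a n p\<bar> \<le> \<epsilon> n"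
    and \<epsilon>: "\<epsilon> \<longlonglongrightarrow> 0"
    and var: "\<forall>\<^sub>F n in sequentially. (\<Sum>p | prime p \<and> p \<le> n. (a n p)\<^sup>2 * (1 / real p)) = 1"
  defines "Z \<equiv> \<lambda>n m. \<Sum>p | prime p \<and> p \<le> n. a n p * ((if p dvd m then 1 else 0) - 1 / real p)"
  shows "(\<lambda>n. \<Sum>m=1..n. of_real (1 / real n) * iexp (t * Z n m)) \<longlonglongrightarrow> of_real (exp (- (t\<^sup>2 / 2)))"
proof (rule tendstoI)
  fix e :: real assume e: "e > 0"
  let ?C = "exp (4 * t\<^sup>2 * exp (2 * \<bar>t\<bar>))"
  have "(\<lambda>k. 4 * (1 / 4) ^ k * ?C) \<longlonglongrightarrow> 4 * 0 * ?C"
    by (intro tendsto_intros LIMSEQ_power_zero) auto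
  hence "\<forall>\<^sub>F k in sequentially. 4 * (1 / 4) ^ k * ?C < e / 2"
    by (rule order_tendstoD(2)) (use e in simp)
  then obtain k where k: "k > 0" "4 * (1 / 4) ^ k * ?C < e / 2"
    using eventually_happens[OF eventually_conj[OF _ eventually_gt_at_top[of 0]]] by auto
  \<comment> \<open>The moment comparison needs an even order, and \<open>2 ^ K = 4 ^ k\<close>. As
    \<open>K\<close> depends only on \<open>e\<close> and \<open>t\<close>, it is fixed when
    \<open>n\<close> grows.\<close>
  define K where "K = 2 * k"
  have K: "even K" "K > 0" "4 / 2 ^ K * ?C < e / 2"
    using k by (auto simp: K_def power_mult power_one_over)
  let ?D = "(\<bar>t\<bar> ^ 3 + t ^ 4 + t\<^sup>2) + t\<^sup>2 / 2 * (4 * real K) + \<bar>t\<bar> * (6 * real K)"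
  have "(\<lambda>n. 3 ^ K / sqrt (real n) * exp \<bar>t\<bar> + ?D * \<epsilon> n) \<longlonglongrightarrow> 0 * exp \<bar>t\<bar> + ?D * 0"
    by (intro tendsto_intros \<epsilon> real_tendsto_divide_at_top[OF tendsto_const]
         filterlim_compose[OF sqrt_at_top] filterlim_real_sequentially)
  hence "\<forall>\<^sub>F n in sequentially. 3 ^ K / sqrt (real n) * exp \<bar>t\<bar> + ?D * \<epsilon> n < e / 2"
    using e by (intro order_tendstoD) auto
  moreover have "\<forall>\<^sub>F n in sequentially. \<epsilon> n < 1" using \<epsilon> by (intro order_tendstoD) auto
  ultimately show "\<forall>\<^sub>F n in sequentially. dist (\<Sum>m=1..n. of_real (1 / real n) * iexp (t * Z n m)) (of_real (exp (- (t\<^sup>2 / 2)))) < e"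
    using a var eventually_ge_at_top[of 2]
  proof eventually_elim
    case (elim n)
    \<comment> \<open>Nonnegativity of \<open>\<epsilon> n\<close> is not assumed; it follows from
      the bound at the prime 2 once \<open>n \<ge> 2\<close>.\<close>
    have "0 \<le> \<bar>a n 2\<bar>" by simp
    also have "\<dots> \<le> \<epsilon> n" using elim two_is_prime_nat by blast
    finally have "cmod ((\<Sum>m=1..n. of_real (1 / real n) * iexp (t * Z n m)) - of_real (exp (- (t\<^sup>2 / 2)))) \<le>
      3 ^ K / sqrt (real n) * exp \<bar>t\<bar> + 4 / 2 ^ K * ?C + ?D * \<epsilon> n"
      unfolding Z_def using elim K by (intro uniform_char_estimate) auto
    also have "\<dots> < e" using elim(1) K(3) by linarith
    finally show ?case by (simp only: dist_norm)
  qed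
qed

section \<open>Convergence in law\<close>

lemma unif_prob_eq_card:
  assumes "n \<ge> 1"
  shows "unif_prob n A = real (card ({1..n} \<inter> A)) / real n"
  using assms by (simp add: unif_prob_def measure_pmf_of_set)

lemma unif_prob_mono_on:
  assumes "n \<ge> 1" "\<And>m. m \<in> {1..n} \<Longrightarrow> m \<in> A \<Longrightarrow> m \<in> B"
  shows "unif_prob n A \<le> unif_prob n B"
  unfolding unif_prob_eq_card[OF assms(1)]
  using assms by (intro divide_right_mono of_nat_mono card_mono) auto

lemma unif_prob_Un_le: "unif_prob n (A \<union> B) \<le> unif_prob n A + unif_prob n B"
  unfolding unif_prob_def by (rule measure_Un_le) auto

lemma unif_prob_bounds: "0 \<le> unif_prob n A" "unif_prob n A \<le> 1"
  unfolding unif_prob_def by (auto simp: measure_pmf.prob_le_1)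

lemma unif_prob_UNIV: "unif_prob n UNIV = 1"
  by (simp add: unif_prob_def)

lemma unif_prob_Collect_gt: "unif_prob n {m. h m > x} = 1 - unif_prob n {m. h m \<le> (x::real)}"
  unfolding unif_prob_def by (subst measure_pmf.prob_compl[symmetric]) (auto intro!: arg_cong2[where f = measure])

text \<open>Slutsky's argument. The exceptional set joins leaving the domain with a large deviation,
  so one hypothesis also gives that the domains have probability tending to 1; continuity of
  \<open>F\<close> absorbs the shift by \<eta>.\<close>

lemma conv_in_law_on_perturb:
  assumes Z: "\<And>x. (\<lambda>n. unif_prob n {m. Z n m \<le> x}) \<longlonglongrightarrow> F x"
    and F: "\<And>x. isCont F x"
    and M: "\<forall>\<^sub>F n in sequentially. M n \<subseteq> {1..n}"
    and close: "\<And>\<eta>. \<eta> > 0 \<Longrightarrow> (\<lambda>n. unif_prob n {m. m \<notin> M n \<or> \<bar>h n m - Z n m\<bar> > \<eta>}) \<longlonglongrightarrow> 0"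
  shows "conv_in_law_on M h F"
  unfolding conv_in_law_on_def
proof (intro conjI allI M)
  show "(\<lambda>n. unif_prob n (M n)) \<longlonglongrightarrow> 1"
  proof (rule tendsto_sandwich)
    show "(\<lambda>n. 1 - unif_prob n {m. m \<notin> M n \<or> \<bar>h n m - Z n m\<bar> > 1}) \<longlonglongrightarrow> 1"
      using tendsto_diff[OF tendsto_const close[of 1], of 1] by simp
    show "\<forall>\<^sub>F n in sequentially. 1 - unif_prob n {m. m \<notin> M n \<or> \<bar>h n m - Z n m\<bar> > 1} \<le> unif_prob n (M n)"
      using eventually_ge_at_top[of 1]
    proof eventually_elim
      case (elim n)
      have "1 = unif_prob n UNIV" by (simp add: unif_prob_UNIV)
      also have "\<dots> \<le> unif_prob n (M n \<union> {m. m \<notin> M n \<or> \<bar>h n m - Z n m\<bar> > 1})"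
        using elim by (intro unif_prob_mono_on) auto
      also have "\<dots> \<le> unif_prob n (M n) + unif_prob n {m. m \<notin> M n \<or> \<bar>h n m - Z n m\<bar> > 1}"
        by (rule unif_prob_Un_le)
      finally show ?case by simp
    qed
  qed (auto simp: unif_prob_bounds)
  fix x
  show "(\<lambda>n. unif_prob n {m \<in> M n. h n m \<le> x}) \<longlonglongrightarrow> F x"
  proof (rule tendstoI)
    fix e :: real assume e: "e > 0"
    obtain d where d: "d > 0" "\<And>y. \<bar>y - x\<bar> < d \<Longrightarrow> \<bar>F y - F x\<bar> < e / 3"
      using F[of x] e unfolding continuous_at_eps_delta dist_real_def by (metis zero_less_divide_iff zero_less_numeral)
    define \<eta> where "\<eta> = d / 2"
    have \<eta>: "\<eta> > 0" using d by (simp add: \<eta>_def)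
    have near: "\<bar>F (x + \<eta>) - F x\<bar> < e / 3" "\<bar>F (x - \<eta>) - F x\<bar> < e / 3"
      using d by (auto simp: \<eta>_def)
    let ?bad = "\<lambda>n. {m. m \<notin> M n \<or> \<bar>h n m - Z n m\<bar> > \<eta>}"
    have "\<forall>\<^sub>F n in sequentially. unif_prob n (?bad n) < e / 3"
      using close[OF \<eta>] e by (intro order_tendstoD) auto
    moreover have "\<forall>\<^sub>F n in sequentially. dist (unif_prob n {m. Z n m \<le> x + \<eta>}) (F (x + \<eta>)) < e / 3"
      using Z e by (intro tendstoD) auto
    moreover have "\<forall>\<^sub>F n in sequentially. dist (unif_prob n {m. Z n m \<le> x - \<eta>}) (F (x - \<eta>)) < e / 3"
      using Z e by (intro tendstoD) auto
    ultimately show "\<forall>\<^sub>F n in sequentially. dist (unif_prob n {m \<in> M n. h n m \<le> x}) (F x) < e"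
      using eventually_ge_at_top[of 1]
    proof eventually_elim
      case (elim n)
      have "unif_prob n {m \<in> M n. h n m \<le> x} \<le> unif_prob n ({m. Z n m \<le> x + \<eta>} \<union> ?bad n)"
        using elim by (intro unif_prob_mono_on) auto
      also have "\<dots> \<le> unif_prob n {m. Z n m \<le> x + \<eta>} + unif_prob n (?bad n)" by (rule unif_prob_Un_le)
      finally have 1: "unif_prob n {m \<in> M n. h n m \<le> x} \<le> unif_prob n {m. Z n m \<le> x + \<eta>} + unif_prob n (?bad n)" .
      have "unif_prob n {m. Z n m \<le> x - \<eta>} \<le> unif_prob n ({m \<in> M n. h n m \<le> x} \<union> ?bad n)"
        using elim by (intro unif_prob_mono_on) auto
      also have "\<dots> \<le> unif_prob n {m \<in> M n. h n m \<le> x} + unif_prob n (?bad n)" by (rule unif_prob_Un_le)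
      finally have 2: "unif_prob n {m. Z n m \<le> x - \<eta>} \<le> unif_prob n {m \<in> M n. h n m \<le> x} + unif_prob n (?bad n)" .
      show ?case using 1 2 elim near unfolding dist_real_def by linarith
    qed
  qed
qed

lemma isCont_std_normal_cdf: "isCont std_normal_cdf x"
proof -
  interpret real_distribution std_normal_distribution by (rule real_dist_normal_dist)
  have "emeasure std_normal_distribution {x} = 0"
    by (subst emeasure_density) (auto intro!: nn_integral_null_set simp: null_sets_def)
  hence "measure std_normal_distribution {x} = 0" by (simp add: measure_def)
  thus ?thesis using isCont_cdf[of x] by (simp add: std_normal_cdf_def[abs_def])
qed

lemma std_normal_cdf_limits: "(std_normal_cdf \<longlongrightarrow> 1) at_top" "(std_normal_cdf \<longlongrightarrow> 0) at_bot"
proof -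
  interpret real_distribution std_normal_distribution by (rule real_dist_normal_dist)
  show "(std_normal_cdf \<longlongrightarrow> 1) at_top" "(std_normal_cdf \<longlongrightarrow> 0) at_bot"
    using cdf_lim_at_top_prob cdf_lim_at_bot by (simp_all add: std_normal_cdf_def[abs_def])
qed

text \<open>Levy's continuity theorem applied to the laws of \<open>Z n\<close>; the limit has no
  atoms, so the distribution functions converge at every point.\<close>

lemma unif_prob_tendsto_std_normal:
  fixes Z :: "nat \<Rightarrow> nat \<Rightarrow> real"
  assumes "\<And>t. (\<lambda>n. \<Sum>m=1..n. of_real (1 / real n) * iexp (t * Z n m)) \<longlonglongrightarrow> of_real (exp (- (t\<^sup>2 / 2)))"
  shows "(\<lambda>n. unif_prob n {m. Z n m \<le> x}) \<longlonglongrightarrow> std_normal_cdf x"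
proof -
  define \<mu> where "\<mu> n = distr (measure_pmf (pmf_of_set {1..n})) borel (Z n)" for n
  have rd: "real_distribution (\<mu> n)" for n
    unfolding \<mu>_def by (rule prob_space.real_distribution_distr[OF prob_space_measure_pmf]) auto
  have "weak_conv_m \<mu> std_normal_distribution"
  proof (rule levy_continuity[OF rd real_dist_normal_dist])
    fix t :: real
    have "char (\<mu> n) t = (\<Sum>m=1..n. of_real (1 / real n) * iexp (t * Z n m))" if "n \<ge> 1" for n
    proof -
      have "char (\<mu> n) t = (\<integral>m. iexp (t * Z n m) \<partial>measure_pmf (pmf_of_set {1..n}))"
        unfolding char_def \<mu>_def by (rule integral_distr) auto
      also have "\<dots> = (\<Sum>m\<in>{1..n}. pmf (pmf_of_set {1..n}) m *\<^sub>R iexp (t * Z n m))"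
        using that by (intro integral_measure_pmf) auto
      also have "\<dots> = (\<Sum>m=1..n. of_real (1 / real n) * iexp (t * Z n m))"
        using that by (intro sum.cong) (auto simp: scaleR_conv_of_real)
      finally show ?thesis .
    qed
    \<comment> \<open>Only eventual equality: at \<open>n = 0\<close> the uniform law on the empty
      set is unspecified.\<close>
    hence "\<forall>\<^sub>F n in sequentially. char (\<mu> n) t = (\<Sum>m=1..n. of_real (1 / real n) * iexp (t * Z n m))"
      by (intro eventually_mono[OF eventually_ge_at_top[of 1]])
    thus "(\<lambda>n. char (\<mu> n) t) \<longlonglongrightarrow> char std_normal_distribution t"
      unfolding char_std_normal_distribution using assms[of t] by (simp add: tendsto_cong)
  qed
  hence "(\<lambda>n. cdf (\<mu> n) x) \<longlonglongrightarrow> std_normal_cdf x"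
    using isCont_std_normal_cdf[of x]
    unfolding weak_conv_m_def weak_conv_def std_normal_cdf_def[abs_def] by auto
  moreover have "cdf (\<mu> n) x = unif_prob n {m. Z n m \<le> x}" for n
    unfolding cdf_def \<mu>_def unif_prob_def by (subst measure_distr) (auto intro!: arg_cong2[where f = measure])
  ultimately show ?thesis by simp
qed

section \<open>Removal of higher prime powers\<close>

text \<open>A union bound over all \<open>d > D\<close>, not only primes: composite \<open>d\<close>
  are needed to exclude high powers of small primes.\<close>

lemma unif_prob_square_divisor_le:
  assumes n: "n \<ge> 1" and D: "D \<ge> 1"
  shows "unif_prob n {m. \<exists>d>D. d\<^sup>2 dvd m} \<le> 1 / real D"
proof -
  have "{1..n} \<inter> {m. \<exists>d>D. d\<^sup>2 dvd m} \<subseteq> (\<Union>d\<in>{D<..n}. {m \<in> {1..n}. d\<^sup>2 dvd m})"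
  proof
    fix m assume "m \<in> {1..n} \<inter> {m. \<exists>d>D. d\<^sup>2 dvd m}"
    then obtain d where d: "d > D" "d\<^sup>2 dvd m" "m \<in> {1..n}" by auto
    have "d \<le> d\<^sup>2" by (simp add: power2_eq_square)
    also have "\<dots> \<le> n" using d dvd_imp_le[OF d(2)] by auto
    finally show "m \<in> (\<Union>d\<in>{D<..n}. {m \<in> {1..n}. d\<^sup>2 dvd m})" using d by auto
  qed
  hence "card ({1..n} \<inter> {m. \<exists>d>D. d\<^sup>2 dvd m}) \<le> card (\<Union>d\<in>{D<..n}. {m \<in> {1..n}. d\<^sup>2 dvd m})"
    by (rule card_mono[rotated]) auto
  also have "\<dots> \<le> (\<Sum>d\<in>{D<..n}. card {m \<in> {1..n}. d\<^sup>2 dvd m})" by (rule card_UN_le) simp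
  also have "\<dots> = (\<Sum>d\<in>{D<..n}. n div d\<^sup>2)"
    by (intro sum.cong refl card_multiples_atMost) auto
  finally have "real (card ({1..n} \<inter> {m. \<exists>d>D. d\<^sup>2 dvd m})) \<le> (\<Sum>d\<in>{D<..n}. real (n div d\<^sup>2))"
    by (simp only: of_nat_sum[symmetric] of_nat_le_iff)
  also have "\<dots> \<le> (\<Sum>d\<in>{D<..n}. real n * (1 / (real d)\<^sup>2))"
  proof (rule sum_mono)
    fix d show "real (n div d\<^sup>2) \<le> real n * (1 / (real d)\<^sup>2)"
      using real_nat_div_bounds(2)[of n "d\<^sup>2"] by simp
  qed
  also have "\<dots> \<le> real n * (1 / real D)"
    unfolding sum_distrib_left[symmetric] by (intro mult_left_mono sum_inverse_squares_le D) auto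
  finally show ?thesis using n by (simp add: unif_prob_eq_card divide_le_eq mult.commute)
qed

lemma additive_arith_prod_prime_powers:
  assumes f: "additive_arith f" and "finite U" "\<And>p. p \<in> U \<Longrightarrow> prime p"
  shows "f (\<Prod>p\<in>U. p ^ e p) = (\<Sum>p\<in>U. f (p ^ e p))"
  using assms(2,3)
proof (induction U rule: finite_induct)
  case empty
  have "f (1 * 1) = f 1 + f 1" using f unfolding additive_arith_def by (metis coprime_1_left zero_less_one)
  thus ?case by simp
next
  case (insert p U)
  have "coprime p r" if "r \<in> U" for r
    using that insert.hyps insert.prems by (intro primes_coprime) auto
  hence "coprime (p ^ e p) (\<Prod>p\<in>U. p ^ e p)" by (intro prod_coprime_right) simp
  moreover have "0 < p ^ e p" "0 < (\<Prod>p\<in>U. p ^ e p)"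
    using insert by (auto intro!: prod_pos simp: prime_gt_0_nat)
  ultimately have "f (p ^ e p * (\<Prod>p\<in>U. p ^ e p)) = f (p ^ e p) + f (\<Prod>p\<in>U. p ^ e p)"
    using f unfolding additive_arith_def by blast
  thus ?case using insert by simp
qed

lemma additive_arith_prime_powers_sum:
  assumes "additive_arith f" "m > 0"
  shows "f m = (\<Sum>p\<in>prime_factors m. f (p ^ multiplicity p m))"
proof -
  have "f (\<Prod>p\<in>prime_factors m. p ^ multiplicity p m) = (\<Sum>p\<in>prime_factors m. f (p ^ multiplicity p m))"
    by (rule additive_arith_prod_prime_powers[OF assms(1)]) auto
  thus ?thesis by (simp only: prime_factorization_nat[OF assms(2), symmetric])
qed

text \<open>Only primes with exponent at least 2 contribute. Without a square divisor beyond
  \<open>D\<^sup>2\<close>, there are at most \<open>D\<close> of them, and both \<open>p\<close>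
  and its full power in \<open>m\<close> are at most \<open>D ^ 3\<close>. The right side is thus a
  finite sum of fixed length, negligible after division by \<open>B n\<close>.\<close>

lemma additive_arith_diff_strongly_additive_le:
  fixes f :: "nat \<Rightarrow> real"
  assumes f: "additive_arith f" and m: "m \<in> {1..n}" and D: "\<not> (\<exists>d>D. d\<^sup>2 dvd m)"
  shows "\<bar>f m - (\<Sum>p | prime p \<and> p \<le> n. if p dvd m then f p else 0)\<bar> \<le>
           real D * (2 * (\<Sum>j\<in>{1..D ^ 3}. \<bar>f j\<bar>))"
proof -
  let ?G = "2 * (\<Sum>j\<in>{1..D ^ 3}. \<bar>f j\<bar>)"
  have "{p \<in> {p. prime p \<and> p \<le> n}. p dvd m} = prime_factors m"
    using m by (auto simp: prime_factors_dvd dest: dvd_imp_le)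
  hence "(\<Sum>p | prime p \<and> p \<le> n. if p dvd m then f p else 0) = (\<Sum>p\<in>prime_factors m. f p)"
    by (subst sum.inter_filter[symmetric]) auto
  hence "f m - (\<Sum>p | prime p \<and> p \<le> n. if p dvd m then f p else 0) =
      (\<Sum>p\<in>prime_factors m. f (p ^ multiplicity p m) - f p)"
    using additive_arith_prime_powers_sum[OF f, of m] m by (simp add: sum_subtractf)
  also have "\<bar>\<dots>\<bar> \<le> (\<Sum>p\<in>prime_factors m. if p \<le> D then ?G else 0)"
  proof (rule order_trans[OF sum_abs], rule sum_mono)
    fix p assume p: "p \<in> prime_factors m"
    define k where "k = multiplicity p m"
    have prime: "prime p" and pm: "p dvd m" using p m by (auto simp: prime_factors_dvd)
    have k: "k \<ge> 1" unfolding k_def using p by (simp add: prime_factors_multiplicity Suc_le_eq)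
    have p1: "p \<ge> 1" using prime by (rule prime_ge_1_nat)
    show "\<bar>f (p ^ multiplicity p m) - f p\<bar> \<le> (if p \<le> D then ?G else 0)"
    proof (cases "k = 1")
      case True
      have "0 \<le> ?G" by (simp add: sum_nonneg)
      thus ?thesis using True by (simp add: k_def)
    next
      case False
      define d where "d = p ^ (k div 2)"
      have "d\<^sup>2 dvd p ^ k" unfolding d_def power_mult[symmetric] by (rule le_imp_power_dvd) simp
      also have "p ^ k dvd m" unfolding k_def by (rule multiplicity_dvd)
      finally have dD: "d \<le> D" using D by (meson not_le)
      have "p ^ 1 \<le> d" unfolding d_def using False k p1 by (intro power_increasing) auto
      hence pD: "p \<le> D" using dD by simp
      \<comment> \<open>For \<open>k \<ge> 2\<close> one has \<open>k \<le> 3 * (k div 2)\<close>;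
        the worst case is \<open>k = 3\<close>.\<close>
      have "p ^ k \<le> d ^ 3" unfolding d_def power_mult[symmetric] using False k p1
        by (intro power_increasing) auto
      also have "\<dots> \<le> D ^ 3" using dD by (rule power_mono) simp
      finally have pk: "p ^ k \<le> D ^ 3" .
      have "p ^ 1 \<le> p ^ k" using k p1 by (intro power_increasing) auto
      hence mem: "p \<in> {1..D ^ 3}" "p ^ k \<in> {1..D ^ 3}" using pk p1 by auto
      have le: "\<bar>f j\<bar> \<le> (\<Sum>j\<in>{1..D ^ 3}. \<bar>f j\<bar>)" if "j \<in> {1..D ^ 3}" for j
        using that by (intro member_le_sum) auto
      show ?thesis using le[OF mem(1)] le[OF mem(2)] pD unfolding k_def by simp
    qed
  qed
  also have "\<dots> = real (card {p \<in> prime_factors m. p \<le> D}) * ?G"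
    by (subst sum.inter_filter[symmetric]) auto
  also have "\<dots> \<le> real D * ?G"
  proof (intro mult_right_mono)
    have "{p \<in> prime_factors m. p \<le> D} \<subseteq> {1..D}" by (auto simp: Suc_le_eq intro!: prime_gt_0_nat)
    from card_mono[OF _ this] show "real (card {p \<in> prime_factors m. p \<le> D}) \<le> real D" by simp
  qed (simp add: sum_nonneg)
  finally show ?thesis .
qed

section \<open>Central limit theorem and delta method\<close>

lemma unif_prob_lessThan_tendsto: "(\<lambda>n. unif_prob n {..<k}) \<longlonglongrightarrow> 0"
proof (rule tendsto_sandwich[OF always_eventually eventually_mono[OF eventually_ge_at_top[of 1]] tendsto_const])
  show "(\<lambda>n. real k / real n) \<longlonglongrightarrow> 0"
    by (intro real_tendsto_divide_at_top[OF tendsto_const] filterlim_real_sequentially)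
  fix n :: nat assume n: "n \<ge> 1"
  have "card ({1..n} \<inter> {..<k}) \<le> card {..<k}" by (rule card_mono) auto
  thus "unif_prob n {..<k} \<le> real k / real n"
    unfolding unif_prob_eq_card[OF n] by (intro divide_right_mono) auto
qed (simp add: unif_prob_bounds)

text \<open>Dividing by \<open>B n\<close> makes the variances sum to exactly 1, and the centring of
  \<open>Z\<close> is \<open>A n / B n\<close>. So \<open>Z\<close> differs from the normalised
  \<open>f n\<close> only through higher prime powers.\<close>

theorem erdos_kac_sequence:
  fixes f :: "nat \<Rightarrow> nat \<Rightarrow> real" and A B :: "nat \<Rightarrow> real"
  assumes additive: "\<And>n. n \<ge> 1 \<Longrightarrow> additive_arith (f n)"
    and A_eq: "\<And>n. A n = A_sum (f n) n"
    and B_eq: "\<And>n. B n = B_sum (f n) n"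
    and B_pos: "\<And>n. n \<ge> n0 \<Longrightarrow> B n > 0"
    and fixed_m: "\<And>m. m \<ge> 1 \<Longrightarrow> (\<lambda>n. f n m / B n) \<longlonglongrightarrow> 0"
    and max_prime: "(\<lambda>n. Max ((\<lambda>p. \<bar>f n p\<bar>) ` {p. prime p \<and> p \<le> n}) / B n) \<longlonglongrightarrow> 0"
  shows "(\<lambda>n. unif_prob n {m. (f n m - A n) / B n \<le> x}) \<longlonglongrightarrow> std_normal_cdf x"
proof -
  define a where "a n p = f n p / B n" for n p
  define \<epsilon> where "\<epsilon> n = Max ((\<lambda>p. \<bar>f n p\<bar>) ` {p. prime p \<and> p \<le> n}) / B n" for n
  define Z where "Z n m = (\<Sum>p | prime p \<and> p \<le> n. a n p * ((if p dvd m then 1 else 0) - 1 / real p))" for n m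
  have fin: "finite {p. prime p \<and> p \<le> n}" for n :: nat by (rule finite_subset[of _ "{..n}"]) auto
  have a_le: "\<forall>\<^sub>F n in sequentially. \<forall>p. prime p \<longrightarrow> p \<le> n \<longrightarrow> \<bar>a n p\<bar> \<le> \<epsilon> n"
    using eventually_ge_at_top[of n0]
  proof eventually_elim
    case (elim n)
    show ?case
    proof safe
      fix p :: nat assume p: "prime p" "p \<le> n"
      hence "\<bar>f n p\<bar> \<le> Max ((\<lambda>p. \<bar>f n p\<bar>) ` {p. prime p \<and> p \<le> n})"
        using fin[of n] by (intro Max_ge) auto
      thus "\<bar>a n p\<bar> \<le> \<epsilon> n"
        using B_pos[OF elim] unfolding a_def \<epsilon>_def by (simp add: divide_right_mono)
    qed
  qed
  have var: "\<forall>\<^sub>F n in sequentially. (\<Sum>p | prime p \<and> p \<le> n. (a n p)\<^sup>2 * (1 / real p)) = 1"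
    using eventually_ge_at_top[of n0]
  proof eventually_elim
    case (elim n)
    have B2: "(B n)\<^sup>2 = (\<Sum>p | prime p \<and> p \<le> n. (f n p)\<^sup>2 / real p)"
      unfolding B_eq B_sum_def by (simp add: sum_nonneg)
    have "(\<Sum>p | prime p \<and> p \<le> n. (a n p)\<^sup>2 * (1 / real p)) =
      (\<Sum>p | prime p \<and> p \<le> n. (f n p)\<^sup>2 / real p) / (B n)\<^sup>2"
      unfolding sum_divide_distrib by (intro sum.cong) (auto simp: a_def power_divide)
    thus ?case unfolding B2[symmetric] using B_pos[OF elim] by simp
  qed
  have "\<epsilon> \<longlonglongrightarrow> 0" using max_prime by (simp add: \<epsilon>_def[abs_def])
  hence lim: "(\<lambda>n. unif_prob n {m. Z n m \<le> x}) \<longlonglongrightarrow> std_normal_cdf x" for x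
    unfolding Z_def by (intro unif_prob_tendsto_std_normal uniform_char_tendsto[OF a_le _ var])
  have "conv_in_law_on (\<lambda>n. {1..n}) (\<lambda>n m. (f n m - A n) / B n) std_normal_cdf"
  proof (rule conv_in_law_on_perturb[OF lim isCont_std_normal_cdf])
    fix \<eta> :: real assume \<eta>: "\<eta> > 0"
    let ?bad = "\<lambda>n. {m. m \<notin> {1..n} \<or> \<bar>(f n m - A n) / B n - Z n m\<bar> > \<eta>}"
    show "(\<lambda>n. unif_prob n (?bad n)) \<longlonglongrightarrow> 0"
    proof (rule tendstoI)
      fix e :: real assume e: "e > 0"
      \<comment> \<open>\<open>D\<close> is chosen before \<open>n\<close>: it bounds the
        exceptional probability by \<open>1 / D\<close>, and leaves only the finitely many arguments
        up to \<open>D ^ 3\<close> for \<open>fixed_m\<close>.\<close>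
      obtain D :: nat where D: "D > 0" "1 / real D < e"
        using e real_arch_inverse[of e] by (auto simp: inverse_eq_divide)
      have "(\<lambda>n. real D * (2 * (\<Sum>j\<in>{1..D ^ 3}. \<bar>f n j / B n\<bar>))) \<longlonglongrightarrow>
          real D * (2 * (\<Sum>j\<in>{1..D ^ 3}. \<bar>0\<bar>))"
        by (intro tendsto_intros fixed_m) auto
      hence "\<forall>\<^sub>F n in sequentially. real D * (2 * (\<Sum>j\<in>{1..D ^ 3}. \<bar>f n j / B n\<bar>)) < \<eta>"
        by (rule order_tendstoD(2)) (use \<eta> in simp)
      thus "\<forall>\<^sub>F n in sequentially. dist (unif_prob n (?bad n)) 0 < e"
        using eventually_ge_at_top[of n0] eventually_ge_at_top[of 1]
      proof eventually_elim
        case (elim n)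
        have B: "B n > 0" using B_pos elim by simp
        have "\<bar>(f n m - A n) / B n - Z n m\<bar> \<le> real D * (2 * (\<Sum>j\<in>{1..D ^ 3}. \<bar>f n j / B n\<bar>))"
          if m: "m \<in> {1..n}" and nd: "\<not> (\<exists>d>D. d\<^sup>2 dvd m)" for m
        proof -
          have "Z n m = (\<Sum>p | prime p \<and> p \<le> n. ((if p dvd m then f n p else 0) - f n p / real p) / B n)"
            unfolding Z_def a_def by (intro sum.cong) (auto simp: field_simps)
          also have "\<dots> = ((\<Sum>p | prime p \<and> p \<le> n. if p dvd m then f n p else 0) - A n) / B n"
            unfolding A_eq A_sum_def sum_divide_distrib[symmetric] sum_subtractf ..
          finally have "(f n m - A n) / B n - Z n m =
              (f n m - (\<Sum>p | prime p \<and> p \<le> n. if p dvd m then f n p else 0)) / B n"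
            by (simp add: diff_divide_distrib)
          also have "\<bar>\<dots>\<bar> \<le> real D * (2 * (\<Sum>j\<in>{1..D ^ 3}. \<bar>f n j\<bar>)) / B n"
            unfolding abs_divide using B
            by (simp only: abs_of_pos) (intro divide_right_mono additive_arith_diff_strongly_additive_le additive m nd elim, auto)
          also have "\<dots> = real D * (2 * (\<Sum>j\<in>{1..D ^ 3}. \<bar>f n j / B n\<bar>))"
            using B by (simp add: sum_divide_distrib[symmetric])
          finally show ?thesis .
        qed
        hence "unif_prob n (?bad n) \<le> unif_prob n {m. \<exists>d>D. d\<^sup>2 dvd m}"
          using elim by (intro unif_prob_mono_on) force+
        also have "\<dots> \<le> 1 / real D" using elim D by (intro unif_prob_square_divisor_le) auto
        also have "\<dots> < e" by (rule D(2))
        finally show ?case by (simp add: unif_prob_bounds)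
      qed
    qed
  qed auto
  hence "(\<lambda>n. unif_prob n {m \<in> {1..n}. (f n m - A n) / B n \<le> x}) \<longlonglongrightarrow> std_normal_cdf x"
    unfolding conv_in_law_on_def by blast
  moreover have "\<forall>\<^sub>F n in sequentially. unif_prob n {m \<in> {1..n}. (f n m - A n) / B n \<le> x} =
      unif_prob n {m. (f n m - A n) / B n \<le> x}"
    using eventually_ge_at_top[of 1] by eventually_elim (intro antisym unif_prob_mono_on, auto)
  ultimately show ?thesis by (rule Lim_transform_eventually)
qed

theorem theorem2:
  fixes f :: "nat \<Rightarrow> nat \<Rightarrow> real"
    and A B :: "nat \<Rightarrow> real"
    and n0 :: nat
    and g :: "real \<Rightarrow> real"
    and g' \<delta> :: real
  assumes additive: "\<And>n. n \<ge> 1 \<Longrightarrow> additive_arith (f n)"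
    and A_eq: "\<And>n. A n = A_sum (f n) n"
    and B_eq: "\<And>n. B n = B_sum (f n) n"
    and nondeg: "\<And>n. n \<ge> n0 \<Longrightarrow> A n \<noteq> 0 \<and> B n > 0"
    and delta: "\<delta> > 0"
    and deriv: "(g has_real_derivative g') (at 1)"
    and deriv_nz: "g' \<noteq> 0"
    and fixed_m: "\<And>m. m \<ge> 1 \<Longrightarrow> (\<lambda>n. f n m / B n) \<longlonglongrightarrow> 0"
    and max_prime: "(\<lambda>n. Max ((\<lambda>p. \<bar>f n p\<bar>) ` {p. prime p \<and> p \<le> n}) / B n) \<longlonglongrightarrow> 0"
    and ratio: "filterlim (\<lambda>n. \<bar>A n\<bar> / B n) at_top sequentially"
  shows "conv_in_law_on
           (\<lambda>n. {m \<in> {n0..n}. f n m / A n \<in> {1 - \<delta>..1 + \<delta>}})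
           (\<lambda>n m. (g (f n m / A n) - g 1) / (g' * (B n / A n)))
           std_normal_cdf"
proof (rule conv_in_law_on_perturb)
  let ?Z = "\<lambda>n m. (f n m - A n) / B n"
  let ?M = "\<lambda>n. {m \<in> {n0..n}. f n m / A n \<in> {1 - \<delta>..1 + \<delta>}}"
  let ?h = "\<lambda>n m. (g (f n m / A n) - g 1) / (g' * (B n / A n))"
  show Z: "(\<lambda>n. unif_prob n {m. ?Z n m \<le> x}) \<longlonglongrightarrow> std_normal_cdf x" for x
    by (rule erdos_kac_sequence[OF additive A_eq B_eq conjunct2[OF nondeg] fixed_m max_prime])
  show "isCont std_normal_cdf x" for x by (rule isCont_std_normal_cdf)
  have no_primes: "{p. prime p \<and> p \<le> (0::nat)} = {}" by auto
  \<comment> \<open>The empty sum contradicts \<open>A n \<noteq> 0\<close> at \<open>n = 0\<close>,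
    so \<open>n0 \<ge> 1\<close> and the domains avoid 0.\<close>
  have "A 0 = 0" unfolding A_eq A_sum_def no_primes by simp
  hence "n0 \<ge> 1" using nondeg[of 0] by (cases n0) auto
  thus "\<forall>\<^sub>F n in sequentially. ?M n \<subseteq> {1..n}" by (intro always_eventually) auto
  fix \<eta> :: real assume \<eta>: "\<eta> > 0"
  let ?bad = "\<lambda>n. {m. m \<notin> ?M n \<or> \<bar>?h n m - ?Z n m\<bar> > \<eta>}"
  show "(\<lambda>n. unif_prob n (?bad n)) \<longlonglongrightarrow> 0"
  proof (rule tendstoI)
    fix e :: real assume e: "e > 0"
    have "\<forall>\<^sub>F y in at_top. std_normal_cdf y > 1 - e / 4" "\<forall>\<^sub>F y in at_bot. std_normal_cdf y < e / 4"
      by (rule order_tendstoD[OF std_normal_cdf_limits(1)] order_tendstoD[OF std_normal_cdf_limits(2)]; use e in simp)+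
    then obtain y1 y2 where y: "\<And>y. y \<ge> y1 \<Longrightarrow> std_normal_cdf y > 1 - e / 4"
       "\<And>y. y \<le> y2 \<Longrightarrow> std_normal_cdf y < e / 4"
      unfolding eventually_at_top_linorder eventually_at_bot_linorder by blast
    \<comment> \<open>The normal law puts mass less than \<open>e / 2\<close> outside
      \<open>[-l, l]\<close>; \<open>l \<ge> 1\<close> permits division by \<open>l\<close>.\<close>
    define l where "l = max 1 (max y1 (- y2))"
    have l: "l \<ge> 1" "std_normal_cdf l > 1 - e / 4" "std_normal_cdf (- l) < e / 4"
      using y(1)[of l] y(2)[of "-l"] by (auto simp: l_def)
    \<comment> \<open>Chosen so that the linearisation error,
      \<open>\<kappa> / \<bar>g'\<bar>\<close> times \<open>\<bar>?Z n m\<bar>\<close>, is at most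
      \<eta> while \<open>\<bar>?Z n m\<bar> \<le> l\<close>.\<close>
    define \<kappa> where "\<kappa> = \<eta> * \<bar>g'\<bar> / l"
    have \<kappa>: "\<kappa> > 0" using \<eta> deriv_nz l by (simp add: \<kappa>_def)
    obtain d where d: "d > 0" "\<And>y. \<bar>y - 1\<bar> < d \<Longrightarrow> \<bar>g y - g 1 - g' * (y - 1)\<bar> \<le> \<kappa> * \<bar>y - 1\<bar>"
      using deriv \<kappa> unfolding has_field_derivative_def has_derivative_at_alt by auto
    \<comment> \<open>On \<open>\<bar>?Z n m\<bar> \<le> l\<close> the ratio
      \<open>f n m / A n\<close> is within \<open>l * B n / \<bar>A n\<bar>\<close> of 1. Below
      \<open>d\<close> the derivative estimate holds, below \<delta> the point lies in the
      domain.\<close>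
    have "(\<lambda>n. l * inverse (\<bar>A n\<bar> / B n)) \<longlonglongrightarrow> l * 0"
      by (intro tendsto_intros tendsto_inverse_0_at_top ratio)
    hence "\<forall>\<^sub>F n in sequentially. l * inverse (\<bar>A n\<bar> / B n) < min d \<delta>"
      by (rule order_tendstoD(2)) (use d delta in simp)
    moreover have "\<forall>\<^sub>F n in sequentially. unif_prob n {..<n0} < e / 4"
      using unif_prob_lessThan_tendsto[of n0] e by (intro order_tendstoD) auto
    moreover have "\<forall>\<^sub>F n in sequentially. unif_prob n {m. ?Z n m \<le> l} > 1 - e / 4"
      using Z[of l] l by (intro order_tendstoD) auto
    moreover have "\<forall>\<^sub>F n in sequentially. unif_prob n {m. ?Z n m \<le> - l} < e / 4"
      using Z[of "-l"] l by (intro order_tendstoD) auto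
    ultimately show "\<forall>\<^sub>F n in sequentially. dist (unif_prob n (?bad n)) 0 < e"
      using eventually_ge_at_top[of n0] eventually_ge_at_top[of 1]
    proof eventually_elim
      case (elim n)
      have A: "A n \<noteq> 0" and B: "B n > 0" using nondeg elim by auto
      have good: "m \<in> ?M n \<and> \<bar>?h n m - ?Z n m\<bar> \<le> \<eta>"
        if m: "m \<in> {1..n}" "m \<ge> n0" and Zm: "\<bar>?Z n m\<bar> \<le> l" for m
      proof -
        define y where "y = f n m / A n"
        define c where "c = B n / A n"
        have c: "c \<noteq> 0" using A B by (simp add: c_def)
        \<comment> \<open>The same signed factor \<open>c\<close> occurs in the normalisation of
          \<open>?h\<close>, so a negative \<open>A n\<close> causes no change of sign.\<close>
        have y1: "y - 1 = ?Z n m * c" using A B by (simp add: y_def c_def field_simps)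
        have "\<bar>y - 1\<bar> \<le> l * \<bar>c\<bar>" unfolding y1 abs_mult using Zm by (rule mult_right_mono) simp
        also have "\<dots> = l * inverse (\<bar>A n\<bar> / B n)" using B by (simp add: c_def field_simps)
        also have "\<dots> < min d \<delta>" by (rule elim(1))
        finally have close: "\<bar>y - 1\<bar> < d" "\<bar>y - 1\<bar> < \<delta>" by auto
        have "?h n m - ?Z n m = (g y - g 1 - g' * (y - 1)) / (g' * c)"
          unfolding y_def[symmetric] c_def[symmetric] y1 using c deriv_nz by (simp add: field_simps)
        also have "\<bar>\<dots>\<bar> \<le> \<kappa> * \<bar>y - 1\<bar> / \<bar>g' * c\<bar>"
          unfolding abs_divide using d(2)[OF close(1)] by (intro divide_right_mono) auto
        also have "\<dots> = \<kappa> / \<bar>g'\<bar> * \<bar>?Z n m\<bar>" unfolding y1 using c deriv_nz by (simp add: abs_mult)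
        also have "\<dots> \<le> \<kappa> / \<bar>g'\<bar> * l" using Zm \<kappa> by (intro mult_left_mono) auto
        also have "\<dots> = \<eta>" using l deriv_nz by (simp add: \<kappa>_def)
        finally show ?thesis using m close(2) by (auto simp: y_def[symmetric] abs_less_iff)
      qed
      \<comment> \<open>Each of the three sets has probability below \<open>e / 4\<close>: the
        initial segment and the two tails of \<open>?Z\<close>.\<close>
      have "unif_prob n (?bad n) \<le> unif_prob n ({..<n0} \<union> ({m. ?Z n m > l} \<union> {m. ?Z n m \<le> - l}))"
      proof (rule unif_prob_mono_on)
        fix m assume "m \<in> {1..n}" "m \<in> ?bad n"
        thus "m \<in> {..<n0} \<union> ({m. ?Z n m > l} \<union> {m. ?Z n m \<le> - l})"
          using good[of m] by (force simp: abs_le_iff not_le)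
      qed (use elim in simp)
      also have "\<dots> \<le> unif_prob n {..<n0} + (unif_prob n {m. ?Z n m > l} + unif_prob n {m. ?Z n m \<le> - l})"
        by (intro order_trans[OF unif_prob_Un_le] add_left_mono unif_prob_Un_le)
      also have "\<dots> < e" using e elim(2-4) unfolding unif_prob_Collect_gt by linarith
      finally show ?case by (simp add: unif_prob_bounds)
    qed
  qed
qed

end
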